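(* Let $n>1$ and $k\ge3$, and let $B(K,\mathbf{B}_0)$ be a $k$-beaded necklace subordinated to a non-trivial, smooth $n$-knot $K\subset\mathbb{S}^{n+2}$ whose knot group $\pi_1(\mathbb{S}^{n+2}\smallsetminus K)$ is bigger than $\mathbb{Z}$ (i.e. is not infinite cyclic). Let $\Gamma_{\mathbf{B}_0}$ be the group generated by the inversions through the $(n+1)$-spheres $\partial B_j$, where $B_j$, $j=1,\dots,k$, are the beads, and let $\Lambda(\Gamma_{\mathbf{B}_0})$ be its Kleinian limit set. Then the corresponding inverse limit space $\mathcal{K}$ is wild at every point of $\Lambda(\Gamma_{\mathbf{B}_0})$.
   Context: $\mathbb{S}^m$ is the unit sphere in $\mathbb{R}^{m+1}$ with its standard metric, and $\mathbb{D}^m$ is the closed unit $m$-disk. Knots. A smooth $n$-knot $K\subset\mathbb{S}^{n+2}$ is the image of a smooth embedding $\mathbb{S}^n\to\mathbb{S}^{n+2}$. It is non-trivial if no homeomorphism of $\mathbb{S}^{n+2}$ maps it onto the standard $\mathbb{S}^n\subset\mathbb{S}^{n+2}$. For a subset $N\subset\mathbb{S}^{n+2}$ homeomorphic to $\mathbb{S}^n$, a point $x\in N$ is locally flat if there is an open neighborhood $U$ of $x$ in $\mathbb{S}^{n+2}$ and a homeomorphism of pairs $(U,U\cap N)\cong(\mathrm{Int}(\mathbb{D}^{n+2}),\mathrm{Int}(\mathbb{D}^n))$ (standard pair); otherwise $N$ is said to be wild at $x$. Beaded necklaces. A $k$-beaded necklace ($k\ge3$) subordinated to $K$ is a set $B(K,\mathbf{B}_0)=K\cup\mathbf{B}_0$,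 where $\mathbf{B}_0=\bigcup_{j=1}^kB_j$ and the beads $B_1,\dots,B_k$ are pairwise disjoint round closed $(n+2)$-balls in $\mathbb{S}^{n+2}$ centered at points of $K$, with radii so small that each pair $(B_j,B_j\cap K)$ is a trivial $n$-tangle, i.e. there is an orientation-preserving homeomorphism $B_j\to\mathbb{D}^{n+2}$ taking $B_j\cap K$ onto the standard $\mathbb{D}^n\subset\mathbb{D}^{n+2}$. Inverting process. Let $I_j$ be the inversion (conformal reflection) of $\mathbb{S}^{n+2}$ through the round sphere $\partial B_j$; it fixes $\partial B_j$ pointwise and exchanges its two complementary components. Let $\Gamma_{\mathbf{B}_0}$ be the group generated by $I_1,\dots,I_k$. Put $K_0=K$. For $m\ge 0$ the stage-$m$ beads are the $k(k-1)^m$ disjoint balls $I_{j_0}I_{j_1}\cdots I_{j_{m-1}}(B_{j_m})$, where $j_0,\dots,j_m\in\{1,\dots,k\}$ and $j_i\neq j_{i+1}$ for all $i$; $\mathbf{B}_m$ is their union. For $m\ge1$ the thread $K_m$ is obtained from $K_{m-1}$ by replacing, for every stage-$(m-1)$ bead $g(B_j)$ with $g=I_{j_0}\cdots I_{j_{m-2}}$ (the identity if $m=1$) and $j=j_{m-1}$, where $j_0,\dots,j_{m-1}\in\{1,\dots,k\}$ and $j_i\neq j_{i+1}$ for all $i$, the part of $K_{m-1}$ inside $g(B_j)$ by $gI_j(K\smallsetminus\mathrm{Int}(B_j))$: $$K_m=\bigl(K_{m-1}\smallsetminus\mathrm{Int}(\mathbf{B}_{m-1})\bigr)\cup\bigcup_{g(B_j)}gI_j\bigl(K\smallsetminus\mathrm{Int}(B_j)\bigr).$$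 Set $B(K_m,\mathbf{B}_m)=K_m\cup\mathbf{B}_m$. These sets are nested decreasing in $m$, and the inverse limit space is $\mathcal{K}=\varprojlim_m B(K_m,\mathbf{B}_m)=\bigcap_{m=0}^\infty B(K_m,\mathbf{B}_m)$, which is homeomorphic to $\mathbb{S}^n$. Limit set. $\Lambda(\Gamma_{\mathbf{B}_0})$ is the set of accumulation points of orbits of $\Gamma_{\mathbf{B}_0}$ in $\mathbb{S}^{n+2}$; it equals $\bigcap_{m\ge0}\mathbf{B}_m$ and is contained in $\mathcal{K}$. *)

theory Defs
  imports "HOL-Homology.Homology" "HOL-Analysis.Analysis" "HOL-Algebra.Bij"
begin

section \<open>Standard pairs\<close>

text \<open>
  \<open>\<real>\<^sup>d \<subset> \<real>\<^sup>d\<^sup>+\<^sup>2\<close> is modelled by \<open>'v \<subset> 'v \<times> real \<times> real\<close> (the Euclidean norm on products), with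
  \<open>DIM('v) = d\<close>. For \<open>'v = real^'n\<close> and \<open>n = CARD('n)\<close>, the pair (Int) \<open>D\<^sup>n \<subset> D\<^sup>n\<^sup>+\<^sup>2\<close> is
  \<open>cball 0 1 \<inter> flat \<subset> cball 0 1\<close> (with \<open>ball\<close> for interiors); for \<open>'v = real \<times> real^'n\<close>, the standard
  pair \<open>S\<^sup>n \<subset> S\<^sup>n\<^sup>+\<^sup>2\<close> is \<open>sphere 0 1 \<inter> flat \<subset> sphere 0 1\<close>.
\<close>

type_synonym 'n disk_space = "(real^'n) \<times> real \<times> real"
type_synonym 'n sphere_space = "(real \<times> (real^'n)) \<times> real \<times> real"

definition flat :: "('v::euclidean_space \<times> real \<times> real) set" where
  "flat = {z. snd z = 0}"

abbreviation unit_sphere :: "'a::euclidean_space set" where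
  "unit_sphere \<equiv> sphere 0 1"

definition pair_homeomorphism ::
  "'a::topological_space set \<Rightarrow> 'a set \<Rightarrow> 'b::topological_space set \<Rightarrow> 'b set \<Rightarrow> ('a \<Rightarrow> 'b) \<Rightarrow> ('b \<Rightarrow> 'a) \<Rightarrow> bool"
where
  "pair_homeomorphism A A' B B' h g \<longleftrightarrow> homeomorphism A B h g \<and> h ` A' = B'"

section \<open>Smooth knots\<close>

primrec differentiable_of_order_on ::
  "nat \<Rightarrow> 'a set \<Rightarrow> ('a::real_normed_vector \<Rightarrow> 'b::real_normed_vector) \<Rightarrow> bool"
where
  "differentiable_of_order_on 0 U f \<longleftrightarrow> continuous_on U f"
| "differentiable_of_order_on (Suc m) U f \<longleftrightarrow>
     (\<forall>x\<in>U. f differentiable (at x)) \<and>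
     (\<forall>v. differentiable_of_order_on m U (\<lambda>x. frechet_derivative f (at x) v))"

definition smooth_on :: "'a set \<Rightarrow> ('a::real_normed_vector \<Rightarrow> 'b::real_normed_vector) \<Rightarrow> bool" where
  "smooth_on U f \<longleftrightarrow> (\<forall>m. differentiable_of_order_on m U f)"

text \<open>
  A map on the sphere is smooth iff it extends to a smooth map on an open neighbourhood; below
  \<open>f\<close> is such an extension. The vectors \<open>v\<close> with \<open>x \<bullet> v = 0\<close> form the tangent space at \<open>x\<close>.
\<close>

definition smooth_sphere_embedding :: "('a::euclidean_space \<Rightarrow> 'b::euclidean_space) \<Rightarrow> bool" where
  "smooth_sphere_embedding f \<longleftrightarrow>
     (\<exists>U. open U \<and> unit_sphere \<subseteq> U \<and> smooth_on U f) \<and>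
     (\<forall>x\<in>unit_sphere. \<forall>v. x \<bullet> v = 0 \<longrightarrow> frechet_derivative f (at x) v = 0 \<longrightarrow> v = 0) \<and>
     (\<exists>g. homeomorphism unit_sphere (f ` unit_sphere) f g)"

definition smooth_knot :: "('v::euclidean_space \<times> real \<times> real) set \<Rightarrow> bool" where
  "smooth_knot K \<longleftrightarrow> K \<subseteq> unit_sphere \<and>
     (\<exists>f :: 'v \<Rightarrow> 'v \<times> real \<times> real. smooth_sphere_embedding f \<and> K = f ` unit_sphere)"

definition nontrivial_knot :: "('v::euclidean_space \<times> real \<times> real) set \<Rightarrow> bool" where
  "nontrivial_knot K \<longleftrightarrow>
     \<not> (\<exists>h g :: 'v \<times> real \<times> real \<Rightarrow> 'v \<times> real \<times> real.
          pair_homeomorphism unit_sphere K unit_sphere (unit_sphere \<inter> flat) h g)"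

section \<open>The fundamental group\<close>

definition loops_at :: "'a::topological_space set \<Rightarrow> 'a \<Rightarrow> (real \<Rightarrow> 'a) set" where
  "loops_at S a = {p. path p \<and> path_image p \<subseteq> S \<and> pathstart p = a \<and> pathfinish p = a}"

definition path_class :: "'a::topological_space set \<Rightarrow> (real \<Rightarrow> 'a) \<Rightarrow> (real \<Rightarrow> 'a) set" where
  "path_class S p = {q. homotopic_paths S p q}"

definition fundamental_group :: "'a::topological_space set \<Rightarrow> 'a \<Rightarrow> (real \<Rightarrow> 'a) set monoid" where
  "fundamental_group S a =
     \<lparr>carrier = path_class S ` loops_at S a,
      monoid.mult = (\<lambda>A B. \<Union>p\<in>A. \<Union>q\<in>B. path_class S (p +++ q)),
      one = path_class S (\<lambda>_. a)\<rparr>"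

lemma path_class_eq_iff:
  "p \<in> loops_at S a \<Longrightarrow> path_class S p = path_class S q \<longleftrightarrow> homotopic_paths S p q"
  unfolding path_class_def loops_at_def
  by (auto intro: homotopic_paths_trans homotopic_paths_sym)

lemma path_class_mult:
  assumes "p \<in> loops_at S a" "q \<in> loops_at S a"
  shows "path_class S p \<otimes>\<^bsub>fundamental_group S a\<^esub> path_class S q = path_class S (p +++ q)"
proof -
  have "path_class S (p' +++ q') = path_class S (p +++ q)"
    if "p' \<in> path_class S p" "q' \<in> path_class S q" for p' q'
  proof -
    have "homotopic_paths S (p +++ q) (p' +++ q')"
      using that assms by (intro homotopic_paths_join) (auto simp: path_class_def loops_at_def)
    moreover have "p +++ q \<in> loops_at S a"
      using assms by (auto simp: loops_at_def path_image_join)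
    ultimately show ?thesis
      using path_class_eq_iff by blast
  qed
  moreover have "p \<in> path_class S p" "q \<in> path_class S q"
    using assms by (auto simp: path_class_def loops_at_def)
  ultimately have "(\<Union>p'\<in>path_class S p. \<Union>q'\<in>path_class S q. path_class S (p' +++ q')) =
      path_class S (p +++ q)"
    by blast
  then show ?thesis
    by (simp add: fundamental_group_def)
qed

lemma loops_at_join: "p \<in> loops_at S a \<Longrightarrow> q \<in> loops_at S a \<Longrightarrow> p +++ q \<in> loops_at S a"
  by (auto simp: loops_at_def path_image_join)

lemma group_fundamental_group:
  fixes S :: "'a::real_normed_vector set"
  assumes "a \<in> S"
  shows "group (fundamental_group S a)"
proof -
  have one: "(\<lambda>_. a) \<in> loops_at S a"
    using assms by (auto simp: loops_at_def path_def pathstart_def pathfinish_def path_image_def)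
  have lin: "linepath a a = (\<lambda>_. a)"
    by (auto simp: linepath_def algebra_simps)
  have car: "carrier (fundamental_group S a) = path_class S ` loops_at S a"
    and unit: "\<one>\<^bsub>fundamental_group S a\<^esub> = path_class S (\<lambda>_. a)"
    by (auto simp: fundamental_group_def)
  show ?thesis
  proof (rule groupI)
    fix x y assume "x \<in> carrier (fundamental_group S a)" "y \<in> carrier (fundamental_group S a)"
    then show "x \<otimes>\<^bsub>fundamental_group S a\<^esub> y \<in> carrier (fundamental_group S a)"
      by (auto simp: car path_class_mult loops_at_join)
  next
    show "\<one>\<^bsub>fundamental_group S a\<^esub> \<in> carrier (fundamental_group S a)"
      using one by (simp add: car unit)
  next
    fix x y z assume "x \<in> carrier (fundamental_group S a)" "y \<in> carrier (fundamental_group S a)"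
      "z \<in> carrier (fundamental_group S a)"
    then obtain p q r where *: "p \<in> loops_at S a" "q \<in> loops_at S a" "r \<in> loops_at S a"
      and eq: "x = path_class S p" "y = path_class S q" "z = path_class S r"
      by (auto simp: car)
    have "homotopic_paths S (p +++ (q +++ r)) ((p +++ q) +++ r)"
      using * by (intro homotopic_paths_assoc) (auto simp: loops_at_def)
    then show "x \<otimes>\<^bsub>fundamental_group S a\<^esub> y \<otimes>\<^bsub>fundamental_group S a\<^esub> z =
        x \<otimes>\<^bsub>fundamental_group S a\<^esub> (y \<otimes>\<^bsub>fundamental_group S a\<^esub> z)"
      using * path_class_eq_iff[OF loops_at_join[OF *(1) loops_at_join[OF *(2,3)]], of "(p +++ q) +++ r"]
      by (simp add: eq path_class_mult loops_at_join)
  next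
    fix x assume "x \<in> carrier (fundamental_group S a)"
    then obtain p where p: "p \<in> loops_at S a" and x: "x = path_class S p"
      by (auto simp: car)
    have "homotopic_paths S ((\<lambda>_. a) +++ p) p"
      using homotopic_paths_lid[of p S] p by (auto simp: loops_at_def lin)
    then show "\<one>\<^bsub>fundamental_group S a\<^esub> \<otimes>\<^bsub>fundamental_group S a\<^esub> x = x"
      using path_class_eq_iff[OF loops_at_join[OF one p]]
      by (simp add: unit x path_class_mult one p)
    have rp: "reversepath p \<in> loops_at S a"
      using p by (auto simp: loops_at_def)
    have "homotopic_paths S (reversepath p +++ p) (\<lambda>_. a)"
      using homotopic_paths_linv[of p S] p by (auto simp: loops_at_def lin)
    then have "path_class S (reversepath p) \<otimes>\<^bsub>fundamental_group S a\<^esub> x = \<one>\<^bsub>fundamental_group S a\<^esub>"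
      using path_class_eq_iff[OF loops_at_join[OF rp p]]
      by (simp add: unit x path_class_mult rp p)
    then show "\<exists>y\<in>carrier (fundamental_group S a).
        y \<otimes>\<^bsub>fundamental_group S a\<^esub> x = \<one>\<^bsub>fundamental_group S a\<^esub>"
      using rp by (auto simp: car)
  qed
qed

section \<open>Orientations\<close>

text \<open>
  The upper hemisphere \<open>y \<mapsto> (sqrt (1 - |y|\<^sup>2), y)\<close>, written in the coordinates above; with the
  outward normal first, it is an orientation-preserving embedding \<open>D\<^sup>n\<^sup>+\<^sup>2 \<rightarrow> S\<^sup>n\<^sup>+\<^sup>2\<close> for the standard
  orientations.
\<close>

definition hemisphere :: "'n::finite disk_space \<Rightarrow> 'n sphere_space" where
  "hemisphere y = ((sqrt (1 - (norm y)\<^sup>2), fst y), snd y)"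

text \<open>
  An embedding \<open>e : D\<^sup>n\<^sup>+\<^sup>2 \<rightarrow> S\<^sup>n\<^sup>+\<^sup>2\<close> preserves orientation iff the orientation class \<open>v\<close> of
  \<open>(D\<^sup>n\<^sup>+\<^sup>2, S\<^sup>n\<^sup>+\<^sup>1)\<close> and the orientation class \<open>u\<close> of \<open>S\<^sup>n\<^sup>+\<^sup>2\<close> have the same image in the local
  homology \<open>H\<^sub>n\<^sub>+\<^sub>2(S\<^sup>n\<^sup>+\<^sup>2, S\<^sup>n\<^sup>+\<^sup>2 - {e 0})\<close>. The pair \<open>(u, v)\<close> is normalised by requiring the same of
  \<open>hemisphere\<close>. All groups and maps involved are infinite cyclic and isomorphisms, so that it is
  enough that \<open>v\<close> is not the neutral element.
\<close>

definition orientation_preserving_disk :: "('n::finite disk_space \<Rightarrow> 'n sphere_space) \<Rightarrow> bool" where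
  "orientation_preserving_disk e \<longleftrightarrow>
     (let d = int (CARD('n) + 2);
          X = top_of_set (unit_sphere :: 'n sphere_space set);
          D = top_of_set (cball 0 1 :: 'n disk_space set)
      in \<exists>u \<in> carrier (homology_group d X).
         \<exists>v \<in> carrier (relative_homology_group d D (sphere 0 1)).
           v \<noteq> \<one>\<^bsub>relative_homology_group d D (sphere 0 1)\<^esub> \<and>
           (\<forall>f \<in> {hemisphere, e}.
              hom_induced d D (sphere 0 1) X (unit_sphere - {f 0}) f v =
              hom_induced d X {} X (unit_sphere - {f 0}) id u))"

section \<open>Beaded necklaces\<close>

text \<open>
  The round closed balls of the sphere, with \<open>r\<close> the chordal radius (geodesic radius \<open>\<rho>\<close>
  corresponds to \<open>r = 2 sin (\<rho>/2)\<close>, so that \<open>0 < \<rho> < \<pi>\<close> becomes \<open>0 < r < 2\<close>).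
\<close>

definition round_ball :: "'a::euclidean_space \<Rightarrow> real \<Rightarrow> 'a set" where
  "round_ball c r = unit_sphere \<inter> cball c r"

abbreviation sphere_interior :: "'a::euclidean_space set \<Rightarrow> 'a set" where
  "sphere_interior A \<equiv> top_of_set unit_sphere interior_of A"

text \<open>The disk is mapped to the bead by the inverse \<open>g\<close>, which preserves orientation iff \<open>h\<close> does.\<close>

definition trivial_tangle :: "'n::finite sphere_space set \<Rightarrow> 'n sphere_space set \<Rightarrow> bool" where
  "trivial_tangle B T \<longleftrightarrow>
     (\<exists>h g. pair_homeomorphism B T (cball 0 1 :: 'n disk_space set) (cball 0 1 \<inter> flat) h g \<and>
            orientation_preserving_disk g)"

definition beaded_necklace ::
  "nat \<Rightarrow> 'n::finite sphere_space set \<Rightarrow> (nat \<Rightarrow> 'n sphere_space) \<Rightarrow> (nat \<Rightarrow> real) \<Rightarrow> bool"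
where
  "beaded_necklace k K c r \<longleftrightarrow>
     (\<forall>j\<in>{1..k}. c j \<in> K \<and> 0 < r j \<and> r j < 2 \<and>
        trivial_tangle (round_ball (c j) (r j)) (round_ball (c j) (r j) \<inter> K)) \<and>
     disjoint_family_on (\<lambda>j. round_ball (c j) (r j)) {1..k}"

section \<open>Inversions\<close>

text \<open>
  The conformal reflection of the unit sphere in the boundary of \<open>round_ball c r\<close>. With
  \<open>t = 1 - r\<^sup>2/2\<close>, this boundary is the section of the unit sphere by the hyperplane \<open>x \<bullet> c = t\<close>.
  The reflection is the restriction of the Euclidean inversion in the sphere orthogonal to the
  unit sphere along that section, which has centre \<open>c/t\<close> and squared radius \<open>1/t\<^sup>2 - 1\<close>, or,
  if \<open>t = 0\<close>, of the reflection in the hyperplane \<open>x \<bullet> c = 0\<close>; see the lemmas below.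
\<close>

definition inversion :: "'a::euclidean_space \<Rightarrow> real \<Rightarrow> 'a \<Rightarrow> 'a" where
  "inversion c r x =
     (let t = 1 - r\<^sup>2 / 2
      in ((1 - t\<^sup>2) *\<^sub>R x - (2 * (x \<bullet> c - t)) *\<^sub>R c) /\<^sub>R (1 + t\<^sup>2 - 2 * t * (x \<bullet> c)))"

lemma inversion_eq_hyperplane_reflection:
  assumes "1 - r\<^sup>2 / 2 = 0"
  shows "inversion c r x = x - (2 * (x \<bullet> c)) *\<^sub>R c"
  using assms by (simp add: inversion_def)

lemma inversion_eq_euclidean_inversion:
  fixes c x :: "'a::euclidean_space"
  assumes "norm c = 1" "norm x = 1" "1 - r\<^sup>2 / 2 = t" "t \<noteq> 0" "\<bar>t\<bar> < 1"
  defines "a \<equiv> c /\<^sub>R t"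
  shows "inversion c r x = a + ((1 / t\<^sup>2 - 1) / (dist x a)\<^sup>2) *\<^sub>R (x - a)"
proof -
  define s where "s = x \<bullet> c"
  define N where "N = 1 + t\<^sup>2 - 2 * t * s"
  have "\<bar>s\<bar> \<le> 1"
    using Cauchy_Schwarz_ineq2[of x c] assms by (simp add: s_def)
  then have "t * s \<le> \<bar>t\<bar>"
    using mult_left_le[of "\<bar>s\<bar>" "\<bar>t\<bar>"] abs_ge_self[of "t * s"] by (simp add: abs_mult)
  moreover have "0 < (1 - \<bar>t\<bar>)\<^sup>2"
    using assms(5) by simp
  ultimately have N: "N > 0"
    by (simp add: N_def power2_eq_square algebra_simps)
  have cc: "c \<bullet> c = 1" "x \<bullet> x = 1"
    using assms(1,2) by (simp_all add: norm_eq_1)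
  have "(dist x a)\<^sup>2 = x \<bullet> x - 2 * (s / t) + (c \<bullet> c) / t\<^sup>2"
    unfolding dist_norm power2_norm_eq_inner a_def s_def inner_diff_left inner_diff_right
    by (simp add: inner_commute[of c x]) (simp add: divide_inverse power2_eq_square)
  then have d: "(dist x a)\<^sup>2 = N / t\<^sup>2"
    using assms(4) by (simp add: cc N_def field_simps power2_eq_square)
  have q: "(1 / t\<^sup>2 - 1) / (dist x a)\<^sup>2 = (1 - t\<^sup>2) / N"
    using N assms(4) by (simp add: d field_simps)
  have "1 / t - (1 - t\<^sup>2) / N / t = - (2 * (s - t)) / N"
  proof -
    have "N - (1 - t\<^sup>2) = t * (- (2 * (s - t)))"
      by (simp add: N_def power2_eq_square algebra_simps)
    moreover have "1 / t - (1 - t\<^sup>2) / N / t = (N - (1 - t\<^sup>2)) / (t * N)"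
      using N assms(4) by (simp add: diff_divide_distrib mult.commute)
    ultimately show ?thesis
      using assms(4) by simp
  qed
  then have "a - ((1 - t\<^sup>2) / N) *\<^sub>R a = (- (2 * (s - t)) / N) *\<^sub>R c"
    by (simp add: a_def scaleR_diff_left[symmetric] divide_inverse mult.assoc)
  then have "a + ((1 - t\<^sup>2) / N) *\<^sub>R (x - a) =
      ((1 - t\<^sup>2) / N) *\<^sub>R x + (- (2 * (s - t)) / N) *\<^sub>R c"
    by (simp add: scaleR_diff_right algebra_simps)
  also have "\<dots> = inversion c r x"
    unfolding inversion_def Let_def assms(3) s_def[symmetric] N_def[symmetric]
    by (simp add: scaleR_diff_right divide_inverse mult.commute[of "inverse N"]
        flip: scaleR_minus_left mult_minus_left)
  finally show ?thesis
    by (simp add: q)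
qed

lemma inversion_facts:
  fixes c x :: "'a::euclidean_space"
  assumes "norm c = 1" "norm x = 1" "0 < r" "r < 2"
  defines "t \<equiv> 1 - r\<^sup>2 / 2"
  shows norm_inversion: "norm (inversion c r x) = 1"
    and inversion_involution: "inversion c r (inversion c r x) = x"
    and inversion_fixes_boundary: "dist c x = r \<Longrightarrow> inversion c r x = x"
    and inversion_exchanges: "dist c (inversion c r x) < r \<longleftrightarrow> dist c x > r"
proof -
  have "r\<^sup>2 < 2\<^sup>2"
    using assms(3,4) by (intro power_strict_mono) auto
  moreover have "0 < r\<^sup>2"
    using assms(3) by simp
  ultimately have t: "\<bar>t\<bar> < 1"
    unfolding t_def by (simp add: abs_if)
  then have t1: "1 - t\<^sup>2 > 0"
    using abs_square_less_1 by force
  define s where "s = x \<bullet> c"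
  define N where "N = 1 + t\<^sup>2 - 2 * t * s"
  have "\<bar>s\<bar> \<le> 1"
    using Cauchy_Schwarz_ineq2[of x c] assms(1,2) by (simp add: s_def)
  then have "t * s \<le> \<bar>t\<bar>"
    using mult_left_le[of "\<bar>s\<bar>" "\<bar>t\<bar>"] abs_ge_self[of "t * s"] by (simp add: abs_mult)
  moreover have "0 < (1 - \<bar>t\<bar>)\<^sup>2"
    using t by simp
  ultimately have N: "N > 0"
    by (simp add: N_def power2_eq_square algebra_simps)
  have cc: "c \<bullet> c = 1" "x \<bullet> x = 1"
    using assms(1,2) by (simp_all add: norm_eq_1)
  define y where "y = inversion c r x"
  have y: "y = ((1 - t\<^sup>2) *\<^sub>R x - (2 * (s - t)) *\<^sub>R c) /\<^sub>R N"
    by (simp add: y_def inversion_def Let_def N_def s_def t_def)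
  have yy: "N *\<^sub>R y = (1 - t\<^sup>2) *\<^sub>R x - (2 * (s - t)) *\<^sub>R c"
    using N by (simp add: y)
  have "(N *\<^sub>R y) \<bullet> (N *\<^sub>R y) = N\<^sup>2"
    unfolding yy using cc
    by (simp add: inner_diff_left inner_diff_right s_def[symmetric] inner_commute[of c x] N_def)
       (simp add: power2_eq_square algebra_simps)
  then have "y \<bullet> y = 1"
    using N by (simp add: power2_eq_square)
  then show norm_y: "norm (inversion c r x) = 1"
    by (simp add: y_def norm_eq_1)
  have "N * (y \<bullet> c) = (N *\<^sub>R y) \<bullet> c"
    by simp
  also have "\<dots> = (1 - t\<^sup>2) * s - 2 * (s - t)"
    unfolding yy using cc by (simp add: inner_diff_left s_def)
  finally have ys: "y \<bullet> c = ((1 - t\<^sup>2) * s - 2 * (s - t)) / N"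
    using N by (simp add: field_simps)
  have yst: "y \<bullet> c - t = (1 - t\<^sup>2) * (t - s) / N"
    using N by (simp add: ys field_simps) (simp add: N_def power2_eq_square algebra_simps)
  have yN: "1 + t\<^sup>2 - 2 * t * (y \<bullet> c) = (1 - t\<^sup>2)\<^sup>2 / N"
    using N by (simp add: ys field_simps) (simp add: N_def power2_eq_square algebra_simps)
  have "inversion c r y = ((1 - t\<^sup>2) *\<^sub>R y - (2 * (y \<bullet> c - t)) *\<^sub>R c) /\<^sub>R ((1 - t\<^sup>2)\<^sup>2 / N)"
    unfolding inversion_def Let_def t_def[symmetric] yN ..
  also have "\<dots> = (N *\<^sub>R y + (2 * (s - t)) *\<^sub>R c) /\<^sub>R (1 - t\<^sup>2)"
  proof -
    define q where "q = 1 - t\<^sup>2"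
    have q: "q > 0"
      using t1 by (simp add: q_def)
    have "inverse (q\<^sup>2 / N) * q = inverse q * N"
      "inverse (q\<^sup>2 / N) * (2 * (q * (t - s) / N)) = inverse q * (2 * (t - s))"
      using q N by (simp_all add: divide_simps power2_eq_square)
    then have "(q *\<^sub>R y - (2 * (q * (t - s) / N)) *\<^sub>R c) /\<^sub>R (q\<^sup>2 / N) =
        (N *\<^sub>R y - (2 * (t - s)) *\<^sub>R c) /\<^sub>R q"
      by (simp only: scaleR_diff_right scaleR_scaleR)
    also have "(2 * (t - s)) *\<^sub>R c = - ((2 * (s - t)) *\<^sub>R c)"
      by (metis minus_diff_eq mult_minus_right scaleR_minus_left)
    finally show ?thesis
      by (simp only: yst q_def[symmetric] diff_minus_eq_add)
  qed
  also have "\<dots> = x"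
    using t1 by (simp add: yy)
  finally show "inversion c r (inversion c r x) = x"
    by (simp add: y_def)
  have d: "(dist c z)\<^sup>2 = r\<^sup>2 + 2 * (t - z \<bullet> c)" if "norm z = 1" for z
    using that assms(1)
    by (simp add: dist_norm power2_norm_eq_inner inner_diff_left inner_diff_right norm_eq_1 t_def
        inner_commute)
  show "inversion c r x = x" if "dist c x = r"
  proof -
    have "s = t"
      using d[OF assms(2)] that by (simp add: s_def)
    then have "N = 1 - t\<^sup>2" "y = (1 - t\<^sup>2) *\<^sub>R x /\<^sub>R N"
      by (auto simp: y N_def power2_eq_square)
    then show ?thesis
      using t1 by (simp add: y_def)
  qed
  have "dist c y < r \<longleftrightarrow> (dist c y)\<^sup>2 < r\<^sup>2"
    using assms(3) by (simp flip: abs_le_square_iff not_le)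
  also have "\<dots> \<longleftrightarrow> y \<bullet> c - t > 0"
    using d[of y] norm_y by (auto simp: y_def)
  also have "\<dots> \<longleftrightarrow> s < t"
    using N t1 by (simp add: yst zero_less_divide_iff zero_less_mult_iff)
  also have "\<dots> \<longleftrightarrow> (dist c x)\<^sup>2 > r\<^sup>2"
    using d[OF assms(2)] by (auto simp: s_def)
  also have "\<dots> \<longleftrightarrow> dist c x > r"
    using assms(3) by (simp flip: abs_le_square_iff not_le)
  finally show "dist c (inversion c r x) < r \<longleftrightarrow> dist c x > r"
    by (simp add: y_def)
qed

lemma inversion_in_Bij:
  assumes "norm c = 1" "0 < r" "r < 2"
  shows "restrict (inversion c r) unit_sphere \<in> Bij unit_sphere"
proof -
  have "bij_betw (inversion c r) unit_sphere unit_sphere"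
    by (rule bij_betw_byWitness[where f' = "inversion c r"])
       (use assms in \<open>auto simp: norm_inversion inversion_involution\<close>)
  then show ?thesis
    by (simp add: Bij_def)
qed

section \<open>The inverting process\<close>

context
  fixes k :: nat and K :: "'a::euclidean_space set" and c :: "nat \<Rightarrow> 'a" and r :: "nat \<Rightarrow> real"
begin

definition admissible_words :: "nat \<Rightarrow> nat list set" where
  "admissible_words m = {w. length w = m \<and> set w \<subseteq> {1..k} \<and> distinct_adj w}"

definition word_map :: "nat list \<Rightarrow> 'a \<Rightarrow> 'a" where
  "word_map w = foldr (\<lambda>j f. inversion (c j) (r j) \<circ> f) w id"

definition stage_beads :: "nat \<Rightarrow> 'a set" where
  "stage_beads m =
     (\<Union>w\<in>admissible_words (Suc m). word_map (butlast w) ` round_ball (c (last w)) (r (last w)))"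

text \<open>For a word \<open>w\<close> ending in \<open>j\<close>, \<open>word_map w\<close> is the map \<open>g I\<^sub>j\<close> with \<open>g = word_map (butlast w)\<close>.\<close>

primrec thread :: "nat \<Rightarrow> 'a set" where
  "thread 0 = K"
| "thread (Suc m) =
     (thread m - sphere_interior (stage_beads m)) \<union>
     (\<Union>w\<in>admissible_words (Suc m).
        word_map w ` (K - sphere_interior (round_ball (c (last w)) (r (last w)))))"

definition inverse_limit_space :: "'a set" where
  "inverse_limit_space = (\<Inter>m. thread m \<union> stage_beads m)"

definition inversion_group :: "('a \<Rightarrow> 'a) set" where
  "inversion_group =
     generate (BijGroup unit_sphere) ((\<lambda>j. restrict (inversion (c j) (r j)) unit_sphere) ` {1..k})"

definition limit_set :: "'a set" where
  "limit_set = {y \<in> unit_sphere. \<exists>x\<in>unit_sphere. y islimpt (\<lambda>\<gamma>. \<gamma> x) ` inversion_group}"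

end

section \<open>Wild points\<close>

text \<open>Meant for sets \<open>N\<close> homeomorphic to \<open>S\<^sup>n\<close>; both predicates are total and do not assert this.\<close>

definition locally_flat_at :: "'n::finite sphere_space set \<Rightarrow> 'n sphere_space \<Rightarrow> bool" where
  "locally_flat_at N x \<longleftrightarrow> x \<in> N \<and>
     (\<exists>U h g. openin (top_of_set unit_sphere) U \<and> x \<in> U \<and>
        pair_homeomorphism U (U \<inter> N) (ball 0 1 :: 'n disk_space set) (ball 0 1 \<inter> flat) h g)"

definition wild_at :: "'n::finite sphere_space set \<Rightarrow> 'n sphere_space \<Rightarrow> bool" where
  "wild_at N x \<longleftrightarrow> x \<in> N \<and> \<not> locally_flat_at N x"

end

theory Submission
  imports Defs "HOL-Complex_Analysis.Riemann_Mapping"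
begin

text \<open>
  Let \<open>\<phi>\<close> be the map of the sphere that fixes the complement \<open>D\<close> of the open beads and
  inverts each bead outwards. Then the \<open>m\<close>-th thread is \<open>{y. \<phi>\<^sup>m y \<in> K}\<close>, so that iterating \<open>\<phi>\<close>
  defines a retraction of the complement of the inverse limit space onto \<open>D - K\<close>, which has every
  nonempty word of inversions as a section.

  By the trivial tangles, the complement \<open>E\<close> of \<open>K\<close> can be pushed into \<open>D - K\<close>. Near a point of the
  limit set, some word carries \<open>D\<close> into any given neighbourhood \<open>U\<close>. If the inverse limit space were
  flat in \<open>U\<close>, the identity of \<open>E\<close> would factor up to homotopy through a space homotopy equivalent to
  the circle. Then the knot group embeds in the integers, so it is infinite cyclic or trivial. It is
  not trivial because \<open>E\<close> has the first homology of the complement of a flat subspace of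
  codimension 2.
\<close>

text \<open>Local flatness concerns one neighbourhood \<open>U\<close>, the knot group concerns all
  of \<open>E\<close>. The bridge is that retraction and sections live on different scales: the
  retraction is defined on the whole complement of the limit space, while near the limit set its
  sections have arbitrarily small images. So the part of that complement inside \<open>U\<close>,
  however small \<open>U\<close> is, still dominates \<open>E\<close>, and the fundamental group of
  the full complement never has to be computed. A section exists only over \<open>D - K\<close>, not
  over \<open>E\<close>; this is why \<open>E\<close> has to be pushed out of the beads by a
  homotopy before a word is applied. Domination by a circle bounds the knot group only from above,
  as a subgroup of the integers, so triviality needs an invariant of its own. First homology suits:
  for closed subsets of a Euclidean space, the homology of the complement depends only on the
  homeomorphism type of the subset, so a punctured knot may be replaced by a linear
  subspace.\<close>

section \<open>Simply connected sets have trivial first homology\<close>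

text \<open>Singular simplices are extensional functions, so a path becomes a 1-simplex only after
  \<open>restrict\<close>. Coordinate 1 serves as the path parameter; thus face 0 is the end point
  and face 1 the starting point.\<close>

definition path_simplex :: "(real \<Rightarrow> 'a) \<Rightarrow> (nat \<Rightarrow> real) \<Rightarrow> 'a" where
  "path_simplex p = restrict (\<lambda>x. p (x 1)) (standard_simplex 1)"

definition edge_point :: "real \<Rightarrow> nat \<Rightarrow> real" where
  "edge_point u = (\<lambda>i. if i = 0 then 1 - u else if i = 1 then u else 0)"

lemma standard_simplex_1_iff: "x \<in> standard_simplex 1 \<longleftrightarrow> (\<exists>u\<in>{0..1}. x = edge_point u)"
proof
  assume x: "x \<in> standard_simplex 1"
  then have "x 0 + x 1 = 1" "\<And>i. i > 1 \<Longrightarrow> x i = 0" "0 \<le> x 1" "x 1 \<le> 1"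
    by (auto simp: standard_simplex_def)
  then have "x = edge_point (x 1)"
    unfolding edge_point_def fun_eq_iff by (metis add_diff_cancel_right' less_one linorder_neqE_nat)
  with \<open>0 \<le> x 1\<close> \<open>x 1 \<le> 1\<close> show "\<exists>u\<in>{0..1}. x = edge_point u"
    by (metis atLeastAtMost_iff)
qed (auto simp: standard_simplex_def edge_point_def)

lemma edge_point_1 [simp]: "edge_point u 1 = u" "edge_point u (Suc 0) = u"
  by (simp_all add: edge_point_def)

lemma continuous_on_edge_point: "continuous_on A edge_point"
proof -
  have "continuous_on A (\<lambda>u. edge_point u i)" for i
    by (cases "i = 0"; cases "i = 1") (auto simp: edge_point_def intro!: continuous_intros)
  then show ?thesis
    by (rule continuous_on_coordinatewise_then_product)
qed

lemma path_of_singular_simplex: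
  assumes "singular_simplex 1 (top_of_set S) f"
  shows "path (f \<circ> edge_point)" "path_image (f \<circ> edge_point) \<subseteq> S" "f = path_simplex (f \<circ> edge_point)"
proof -
  have c: "continuous_on (standard_simplex 1) f" and im: "f ` standard_simplex 1 \<subseteq> S"
    and ext: "f \<in> extensional (standard_simplex 1)"
    using assms by (auto simp: singular_simplex_def euclidean_product_topology)
  have "edge_point ` {0..1} \<subseteq> standard_simplex 1"
    using standard_simplex_1_iff by blast
  then show "path (f \<circ> edge_point)" "path_image (f \<circ> edge_point) \<subseteq> S"
    using im continuous_on_compose[OF continuous_on_edge_point continuous_on_subset[OF c], of "{0..1}"]
    unfolding path_def path_image_def by auto
  show "f = path_simplex (f \<circ> edge_point)"
  proof
    fix x
    show "f x = path_simplex (f \<circ> edge_point) x"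
      using ext standard_simplex_1_iff[of x]
      by (auto simp: path_simplex_def extensional_def)
  qed
qed

text \<open>A homotopy with fixed end points is constant on two opposite sides of the square.
  Collapsing these sides turns the square into a triangle to which the homotopy descends: the side
  carrying \<open>g1 +++ p\<close> becomes the broken edge through vertex 1, the side carrying
  \<open>g2\<close> the edge opposite to that vertex.\<close>

lemma triangle_filling:
  fixes S :: "'a::topological_space set"
  assumes "homotopic_paths S (g1 +++ p) g2" "pathfinish g1 = pathstart p"
  obtains \<tau> where "singular_simplex 2 (top_of_set S) \<tau>"
    "singular_face 2 0 \<tau> = path_simplex p" "singular_face 2 1 \<tau> = path_simplex g2"
    "singular_face 2 2 \<tau> = path_simplex g1"
proof -
  obtain H :: "real \<times> real \<Rightarrow> 'a" where H: "continuous_on ({0..1} \<times> {0..1}) H" "H \<in> ({0..1} \<times> {0..1}) \<rightarrow> S"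
    "\<forall>x\<in>{0..1}. H (0, x) = (g1 +++ p) x" "\<forall>x\<in>{0..1}. H (1, x) = g2 x"
    and Hs: "\<forall>t\<in>{0..1}. pathstart (H \<circ> Pair t) = pathstart (g1 +++ p) \<and> pathfinish (H \<circ> Pair t) = pathfinish (g1 +++ p)"
    using assms(1) unfolding homotopic_paths by auto
  have H0: "H (s, 0) = H (0, 0)" "H (s, 1) = H (0, 1)" if "s \<in> {0..1}" for s
    using Hs that H(3) by (auto simp: pathstart_def pathfinish_def)
  \<comment> \<open>\<open>Q (s, t)\<close> moves linearly in \<open>s\<close> from the point at
    time \<open>t\<close> of the broken edge 0, 1, 2 to the point at time \<open>t\<close> of the
    edge from vertex 0 to vertex 2. For \<open>t = 0\<close> and \<open>t = 1\<close> it does not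
    depend on \<open>s\<close>.\<close>
  define Q :: "real \<times> real \<Rightarrow> nat \<Rightarrow> real" where
    "Q = (\<lambda>(s,t) i. if i = 0 then 1 - t - (1 - s) * min t (1 - t)
        else if i = 1 then (1 - s) * min t (1 - t) * 2
        else if i = 2 then t - (1 - s) * min t (1 - t) else 0)"
  \<comment> \<open>An inverse of \<open>Q\<close>: the functional \<open>t\<close> recovers the
    time, and on the simplex \<open>m\<close> vanishes exactly at the vertices 0 and 2, where
    \<open>s\<close> is lost. The default \<open>s = 0\<close> is harmless there, because
    \<open>H\<close> is constant on the collapsed sides.\<close>
  define t where "t x = x 1 / 2 + x 2" for x :: "nat \<Rightarrow> real"
  define m where "m x = min (t x) (1 - t x)" for x
  define \<tau> where "\<tau> x = H (if m x = 0 then 0 else 1 - x 1 / (2 * m x), t x)" for x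
  have S2: "x \<in> standard_simplex 2 \<longleftrightarrow> x 0 \<ge> 0 \<and> x 1 \<ge> 0 \<and> x 2 \<ge> 0 \<and> x 0 + x 1 + x 2 = 1 \<and> (\<forall>i>2. x i = 0)" for x
  proof
    assume "x \<in> standard_simplex 2"
    then show "x 0 \<ge> 0 \<and> x 1 \<ge> 0 \<and> x 2 \<ge> 0 \<and> x 0 + x 1 + x 2 = 1 \<and> (\<forall>i>2. x i = 0)"
      by (auto simp: standard_simplex_def numeral_2_eq_2)
  next
    assume *: "x 0 \<ge> 0 \<and> x 1 \<ge> 0 \<and> x 2 \<ge> 0 \<and> x 0 + x 1 + x 2 = 1 \<and> (\<forall>i>2. x i = 0)"
    have "0 \<le> x i \<and> x i \<le> 1" for i
    proof (cases "i > 2")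
      case False
      then have "i = 0 \<or> i = 1 \<or> i = 2" by auto
      with * show ?thesis by auto
    qed (use * in auto)
    with * show "x \<in> standard_simplex 2"
      by (auto simp: standard_simplex_def numeral_2_eq_2)
  qed
  have Qim: "Q st \<in> standard_simplex 2" if st01: "st \<in> {0..1} \<times> {0..1}" for st
  proof -
    obtain s t where st: "st = (s,t)" "0 \<le> s" "s \<le> 1" "0 \<le> t" "t \<le> 1"
      using st01 by (cases st) auto
    define n where "n = min t (1 - t)"
    have "0 \<le> n" "n \<le> t" "n \<le> 1 - t"
      using st by (auto simp: n_def)
    moreover have "0 \<le> (1 - s) * n" "(1 - s) * n \<le> n"
      using st \<open>0 \<le> n\<close> by (auto simp: mult_left_le_one_le)
    ultimately show ?thesis
      by (simp add: S2 Q_def st(1) n_def[symmetric] del: mult_le_0_iff zero_le_mult_iff)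
  qed
  have \<tau>Q: "\<tau> (Q st) = H st" if st01: "st \<in> {0..1} \<times> {0..1}" for st
  proof -
    obtain s t' where st: "st = (s,t')" "0 \<le> s" "s \<le> 1" "0 \<le> t'" "t' \<le> 1"
      using st01 by (cases st) auto
    have t: "t (Q st) = t'"
      by (simp add: t_def Q_def st(1))
    show ?thesis
    proof (cases "m (Q st) = 0")
      case True
      then have "t' = 0 \<or> t' = 1"
        by (auto simp: m_def t min_def split: if_splits)
      then show ?thesis
        unfolding \<tau>_def t using True H0[of s] st by auto
    next
      case False
      then have "Q st 1 / (2 * m (Q st)) = 1 - s"
        unfolding m_def t by (simp add: Q_def st(1))
      then show ?thesis
        unfolding \<tau>_def t using False st(1) by simp
    qed
  qed
  have surj: "x \<in> Q ` ({0..1} \<times> {0..1})" if "x \<in> standard_simplex 2" for x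
  proof -
    have x: "x 0 \<ge> 0" "x 1 \<ge> 0" "x 2 \<ge> 0" "x 0 + x 1 + x 2 = 1" "\<forall>i>2. x i = 0"
      using that by (auto simp: S2)
    define s where "s = (if m x = 0 then 0 else 1 - x 1 / (2 * m x))"
    have m: "0 \<le> m x" "x 1 \<le> 2 * m x"
      using x by (auto simp: m_def t_def min_def)
    have s: "0 \<le> s" "s \<le> 1"
      using m x by (auto simp: s_def divide_simps)
    have sm: "(1 - s) * m x = x 1 / 2"
      using m x by (auto simp: s_def)
    have "x i = Q (s, t x) i" for i
    proof (cases "i > 2")
      case False
      then have "i = 0 \<or> i = 1 \<or> i = 2" by auto
      then show ?thesis
        using sm x(4) unfolding m_def by (auto simp: Q_def t_def)
    qed (use x in \<open>auto simp: Q_def\<close>)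
    moreover have "t x \<in> {0..1}"
      using x by (auto simp: t_def)
    ultimately show ?thesis
      using s by (intro image_eqI[of _ _ "(s, t x)"]) auto
  qed
  have "continuous_on ({0..1} \<times> {0..1}) (\<lambda>st. Q st i)" for i
    unfolding Q_def split_beta
    by (cases "i = 0"; cases "i = 1"; cases "i = 2") (auto intro!: continuous_intros)
  then have Qc: "continuous_on ({0..1} \<times> {0..1}) Q"
    by (rule continuous_on_coordinatewise_then_product)
  \<comment> \<open>The formula for \<open>\<tau>\<close> divides by \<open>m\<close>, so its
    continuity at two vertices is not visible. It is inherited from \<open>\<tau> \<circ> Q\<close>,
    which is \<open>H\<close>, because a continuous surjection from a compact space onto a Hausdorff
    space is a quotient map.\<close>
  have "quotient_map (top_of_set ({0..1} \<times> {0..1})) (top_of_set (standard_simplex 2)) Q"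
  proof (rule continuous_imp_quotient_map)
    show "compact_space (top_of_set ({0..1::real} \<times> {0..1::real}))"
      by (simp add: compact_Times compact_space_subtopology)
    show "Hausdorff_space (top_of_set (standard_simplex 2))"
      by (simp add: Hausdorff_space_subtopology)
  qed (use Qc Qim surj in \<open>auto\<close>)
  moreover have "continuous_map (top_of_set ({0..1} \<times> {0..1})) (top_of_set S) (\<tau> \<circ> Q)"
    using H(2) \<tau>Q by (auto intro!: continuous_on_eq[OF H(1)])
  ultimately have \<tau>c: "continuous_map (top_of_set (standard_simplex 2)) (top_of_set S) \<tau>"
    by (rule continuous_compose_quotient_map)
  define \<tau>' where "\<tau>' = restrict \<tau> (standard_simplex 2)"
  have ss: "singular_simplex 2 (top_of_set S) \<tau>'"
    using \<tau>c by (simp add: singular_simplex_def \<tau>'_def euclidean_product_topology flip: image_subset_iff_funcset)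
  have face: "singular_face 2 k \<tau>' = path_simplex q"
    if "k \<le> 2" "\<And>u. u \<in> {0..1} \<Longrightarrow> \<tau> (simplical_face k (edge_point u)) = q u" for k q
  proof
    fix x
    show "singular_face 2 k \<tau>' x = path_simplex q x"
    proof (cases "x \<in> standard_simplex 1")
      case True
      then obtain u where u: "u \<in> {0..1}" "x = edge_point u"
        using standard_simplex_1_iff by blast
      have "simplical_face k x \<in> standard_simplex 2"
        using simplical_face_in_standard_simplex[of 2 k x] True that by simp
      then show ?thesis
        using True u that by (simp add: singular_face_def path_simplex_def \<tau>'_def)
    qed (simp add: singular_face_def path_simplex_def)
  qed
  have f0: "\<tau> (simplical_face 0 (edge_point u)) = p u" if "u \<in> {0..1}" for u
  proof -
    have Qe: "Q (0, 1/2 + u/2) = simplical_face 0 (edge_point u)"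
      using that by (auto simp: Q_def simplical_face_def edge_point_def min_def fun_eq_iff)
    have "H (0, 1/2 + u/2) = (g1 +++ p) (1/2 + u/2)"
      using H(3) that by auto
    also have "\<dots> = p u"
      using assms(2) that by (auto simp: joinpaths_def pathfinish_def pathstart_def)
    finally show ?thesis
      using \<tau>Q[of "(0, 1/2 + u/2)"] that Qe by auto
  qed
  have f1: "\<tau> (simplical_face 1 (edge_point u)) = g2 u" if "u \<in> {0..1}" for u
  proof -
    have Qe: "Q (1, u) = simplical_face 1 (edge_point u)"
      by (auto simp: Q_def simplical_face_def edge_point_def fun_eq_iff)
    show ?thesis
      using \<tau>Q[of "(1, u)"] that Qe H(4) by auto
  qed
  have f2: "\<tau> (simplical_face 2 (edge_point u)) = g1 u" if "u \<in> {0..1}" for u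
  proof -
    have Qe: "Q (0, u/2) = simplical_face 2 (edge_point u)"
      using that by (auto simp: Q_def simplical_face_def edge_point_def min_def fun_eq_iff)
    have "H (0, u/2) = (g1 +++ p) (u/2)"
      using H(3) that by auto
    also have "\<dots> = g1 u"
      using that by (auto simp: joinpaths_def)
    finally show ?thesis
      using \<tau>Q[of "(0, u/2)"] that Qe by auto
  qed
  show thesis
    by (rule that[OF ss]; rule face) (simp_all add: f0 f1[unfolded One_nat_def] f2)
qed

text \<open>Join a base point to every \<open>y\<close> by a path \<open>\<gamma> y\<close>. An edge
  from \<open>x\<close> to \<open>y\<close> that is preceded by \<open>\<gamma> x\<close> is
  homotopic to \<open>\<gamma> y\<close>, so the edge is homologous to
  \<open>\<gamma> y - \<gamma> x\<close>. Summed over a chain, these differences depend only on its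
  boundary, and for a cycle they cancel.\<close>

proposition simply_connected_imp_trivial_homology_group_1:
  fixes S :: "'a::real_normed_vector set"
  assumes "simply_connected S"
  shows "trivial_group (homology_group 1 (top_of_set S))"
proof -
  let ?X = "top_of_set S"
  have bd: "singular_relboundary 1 ?X {} c" if c: "singular_relcycle 1 ?X {} c" for c
  proof (cases "S = {}")
    case True
    then have "c = 0"
      using c singular_chain_empty[of ?X 1 c] by (auto simp: singular_relcycle_def)
    then show ?thesis by simp
  next
    case False
    then obtain b where b: "b \<in> S" by auto
    have "\<exists>g. path g \<and> path_image g \<subseteq> S \<and> pathstart g = b \<and> pathfinish g = y" if "y \<in> S" for y
      using simply_connected_imp_path_connected[OF assms] b that
      unfolding path_connected_def by blast
    then obtain \<gamma> where \<gamma>: "\<And>y. y \<in> S \<Longrightarrow> path (\<gamma> y) \<and> path_image (\<gamma> y) \<subseteq> S \<and> pathstart (\<gamma> y) = b \<and> pathfinish (\<gamma> y) = y"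
      by metis
    \<comment> \<open>\<open>pt\<close> reads off the point of a 0-simplex at its only vertex;
      \<open>h\<close> is the linear map on 0-chains that sends a point to the chosen path ending
      there.\<close>
    define pt where "pt s = s (\<lambda>j. if j = 0 then 1 else 0)" for s :: "(nat \<Rightarrow> real) \<Rightarrow> 'a"
    define h where "h = frag_extend (\<lambda>s. frag_of (path_simplex (\<gamma> (pt s))))"
    have "\<exists>\<tau>. singular_simplex 2 ?X \<tau> \<and>
        chain_boundary 2 (frag_of \<tau>) = frag_of f - h (chain_boundary 1 (frag_of f))"
      if f: "singular_simplex 1 ?X f" for f
    proof -
      define p where "p = f \<circ> edge_point"
      note p = path_of_singular_simplex[OF f, folded p_def]
      have S: "pathstart p \<in> S" "pathfinish p \<in> S"
        using p(1,2) by (meson pathstart_in_path_image pathfinish_in_path_image subsetD)+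
      have "homotopic_paths S (\<gamma> (pathstart p) +++ p) (\<gamma> (pathfinish p))"
        using assms p(1,2) \<gamma>[OF S(1)] \<gamma>[OF S(2)]
        unfolding simply_connected_eq_homotopic_paths
        by (simp add: path_image_join)
      from triangle_filling[OF this] \<gamma>[OF S(1)] obtain \<tau> where
        \<tau>: "singular_simplex 2 ?X \<tau>" "singular_face 2 0 \<tau> = f"
          "singular_face 2 1 \<tau> = path_simplex (\<gamma> (pathfinish p))"
          "singular_face 2 2 \<tau> = path_simplex (\<gamma> (pathstart p))"
        using p(3) by metis
      have e: "(\<lambda>j. if j = 0 then 1 else (0::real)) = edge_point 0" "simplical_face 0 (edge_point 0) = edge_point 1"
        "simplical_face 1 (edge_point 0) = edge_point 0" "simplical_face (Suc 0) (edge_point 0) = edge_point 0"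
        by (auto simp: edge_point_def simplical_face_def fun_eq_iff)
      have "edge_point 0 \<in> standard_simplex 0"
        by (auto simp: standard_simplex_0 e)
      then have "pt (singular_face 1 0 f) = pathfinish p" "pt (singular_face 1 1 f) = pathstart p"
        by (auto simp: pt_def singular_face_def e p_def pathstart_def pathfinish_def)
      then have "h (chain_boundary 1 (frag_of f)) =
          frag_of (path_simplex (\<gamma> (pathfinish p))) - frag_of (path_simplex (\<gamma> (pathstart p)))"
        by (simp add: chain_boundary_of h_def frag_extend_diff)
      moreover have "chain_boundary 2 (frag_of \<tau>) =
          frag_of f - frag_of (path_simplex (\<gamma> (pathfinish p))) + frag_of (path_simplex (\<gamma> (pathstart p)))"
        using \<tau> by (simp add: chain_boundary_of numeral_2_eq_2)
      ultimately show ?thesis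
        using \<tau>(1) by auto
    qed
    then obtain \<tau> where \<tau>: "\<And>f. singular_simplex 1 ?X f \<Longrightarrow> singular_simplex 2 ?X (\<tau> f) \<and>
        chain_boundary 2 (frag_of (\<tau> f)) = frag_of f - h (chain_boundary 1 (frag_of f))"
      by metis
    have *: "singular_chain 2 ?X (frag_extend (frag_of \<circ> \<tau>) c) \<and>
        chain_boundary 2 (frag_extend (frag_of \<circ> \<tau>) c) = c - h (chain_boundary 1 c)"
      if "Poly_Mapping.keys c \<subseteq> singular_simplex_set 1 ?X" for c
      using that
    proof (induction c rule: frag_induction)
      case (diff a b)
      then show ?case
        by (simp add: frag_extend_diff singular_chain_diff chain_boundary_diff h_def)
    qed (use \<tau> in \<open>auto simp: singular_chain_of h_def\<close>)
    have "singular_chain 1 ?X c" "chain_boundary 1 c = 0"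
      using c by (auto simp: singular_cycle)
    then show ?thesis
      using *[of c] unfolding singular_boundary singular_chain_def h_def
      by (auto simp: numeral_2_eq_2)
  qed
  have "carrier (homology_group (int 1) ?X) \<subseteq> {singular_relboundary_set 1 ?X {}}"
    unfolding carrier_relative_homology_group
    using bd homologous_rel_set_eq_relboundary[of 1 ?X "{}"] by blast
  then show ?thesis
    unfolding trivial_group_def
    using monoid.one_closed[OF group.is_monoid[OF group_relative_homology_group], of "int 1" ?X "{}"] by auto
qed

section \<open>Complements of spheres of codimension 2\<close>

lemma Euclidean_space_top_of_set: "Euclidean_space n = top_of_set {x. \<forall>i\<ge>n. x i = 0}"
  by (simp add: Euclidean_space_def euclidean_product_topology)

lemma nsphere_top_of_set: "nsphere n = top_of_set {x. (\<Sum>i\<le>n. x i ^ 2) = 1 \<and> (\<forall>i>n. x i = 0)}"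
  by (simp add: nsphere euclidean_product_topology)

text \<open>\<open>f\<close> places the circle in the coordinates \<open>n\<close> and
  \<open>n + 1\<close>, and \<open>g\<close> projects to these and normalises. A map with a left
  inverse is injective on homology, which is impossible from an infinite group into a trivial
  one.\<close>

lemma nontrivial_homology_codim_2_complement:
  "\<not> trivial_group (homology_group 1 (subtopology (Euclidean_space (n + 2))
      (topspace (Euclidean_space (n + 2)) - topspace (Euclidean_space n))))"
    (is "\<not> trivial_group (homology_group 1 ?Y)")
proof
  assume triv: "trivial_group (homology_group 1 ?Y)"
  have Y: "?Y = top_of_set {x. (\<forall>i\<ge>n + 2. x i = 0) \<and> (x n \<noteq> 0 \<or> x (n + 1) \<noteq> 0)}" (is "_ = top_of_set ?YS")
  proof -
    have "n \<le> i \<Longrightarrow> \<not> n + 2 \<le> i \<Longrightarrow> i = n \<or> i = n + 1" for i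
      by linarith
    then have "{x. \<forall>i\<ge>n + 2. x i = 0} - {x. \<forall>i\<ge>n. x i = 0} = (?YS :: (nat \<Rightarrow> real) set)"
      by (auto; metis le_refl le_add1)
    then show ?thesis
      by (simp add: Euclidean_space_top_of_set subtopology_subtopology Int_absorb1 Collect_mono)
  qed
  define f where "f x = (\<lambda>i. if i = n then x 0 else if i = n + 1 then x 1 else 0)" for x :: "nat \<Rightarrow> real"
  define g where "g y = (\<lambda>i::nat. if i = 0 then y n / sqrt ((y n)\<^sup>2 + (y (n+1))\<^sup>2)
      else if i = 1 then y (n+1) / sqrt ((y n)\<^sup>2 + (y (n+1))\<^sup>2) else 0)" for y :: "nat \<Rightarrow> real"
  let ?C = "{x. (\<Sum>i\<le>(1::nat). x i ^ 2) = 1 \<and> (\<forall>i>1. x i = 0)} :: (nat \<Rightarrow> real) set"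
  have proj: "continuous_on A (\<lambda>x::nat \<Rightarrow> real. x i)" for A i
    by (rule continuous_on_product_then_coordinatewise[OF continuous_on_id])
  have cf: "continuous_on ?C f"
  proof (rule continuous_on_coordinatewise_then_product)
    show "continuous_on ?C (\<lambda>x. f x i)" for i
      unfolding f_def by (cases "i = n"; cases "i = n + 1") (auto intro!: proj)
  qed
  have pos: "(y n)\<^sup>2 + (y (n+1))\<^sup>2 > 0" if "y \<in> ?YS" for y
    using that by (auto simp: sum_power2_gt_zero_iff)
  have cg: "continuous_on ?YS g"
  proof (rule continuous_on_coordinatewise_then_product)
    show "continuous_on ?YS (\<lambda>x. g x i)" for i
      unfolding g_def using pos
      by (cases "i = 0"; cases "i = 1") (auto intro!: continuous_intros proj simp: sum_power2_eq_zero_iff)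
  qed
  have "section_map (nsphere 1) ?Y f"
    unfolding section_map_def retraction_maps_def Y nsphere_top_of_set
  proof (intro exI[of _ g] conjI)
    show "continuous_map (top_of_set ?YS) (top_of_set ?C) g"
    proof -
      have "g ` ?YS \<subseteq> ?C"
      proof clarify
        fix y :: "nat \<Rightarrow> real" assume "\<forall>i\<ge>n + 2. y i = 0" "y n \<noteq> 0 \<or> y (n + 1) \<noteq> 0"
        then have p: "(y n)\<^sup>2 + (y (n+1))\<^sup>2 > 0"
          using pos by blast
        then have "(\<Sum>i\<le>1. (g y i)\<^sup>2) = 1"
          by (auto simp: g_def power_divide add_divide_distrib[symmetric])
        then show "(\<Sum>i\<le>1. (g y i)\<^sup>2) = 1 \<and> (\<forall>i>1. g y i = 0)"
          by (simp add: g_def)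
      qed
      with cg show ?thesis by (simp add: image_subset_iff_funcset)
    qed
    show "continuous_map (top_of_set ?C) (top_of_set ?YS) f"
    proof -
      have "f ` ?C \<subseteq> ?YS"
        by (auto simp: f_def)
      with cf show ?thesis by (simp add: image_subset_iff_funcset)
    qed
    show "\<forall>x\<in>topspace (top_of_set ?C). g (f x) = x"
    proof
      fix x assume x: "x \<in> topspace (top_of_set ?C)"
      have "g (f x) i = x i" for i
        using x by (cases "i = 0"; cases "i = 1") (auto simp: f_def g_def)
      then show "g (f x) = x" by auto
    qed
  qed
  then have "inj_on (hom_induced 1 (nsphere 1) {} ?Y {} f) (carrier (homology_group 1 (nsphere 1)))"
    by (rule inj_on_hom_induced_section_map)
  moreover have "hom_induced 1 (nsphere 1) {} ?Y {} f ` carrier (homology_group 1 (nsphere 1)) \<subseteq> carrier (homology_group 1 ?Y)"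
    using hom_induced_empty_hom[of 1 "nsphere 1" ?Y f] unfolding hom_def by blast
  moreover have "finite (carrier (homology_group 1 ?Y))"
    using triv unfolding trivial_group_def by simp
  ultimately have "finite (carrier (homology_group 1 (nsphere 1)))"
    by (rule inj_on_finite)
  moreover have "homology_group 1 (nsphere 1) \<cong> integer_group"
    using reduced_homology_group_nsphere(1)[of 1] un_reduced_homology_group[of 1 "nsphere 1"] by simp
  ultimately have "finite (UNIV :: int set)"
    unfolding is_iso_def iso_def by (auto dest: bij_betw_finite)
  then show False
    using infinite_UNIV_int by blast
qed

text \<open>Without one point of \<open>K\<close>, the sphere is a Euclidean space and the rest of
  \<open>K\<close> a closed copy of a linear subspace of codimension 2. Homeomorphic closed subsets
  of a Euclidean space have complements with isomorphic homology, so the complement of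
  \<open>K\<close> has nontrivial first homology.\<close>

proposition codim_2_sphere_complement_not_simply_connected:
  fixes K :: "'n::finite sphere_space set"
  assumes "K \<subseteq> unit_sphere" "K homeomorphic (unit_sphere :: (real \<times> (real^'n)) set)"
  shows "\<not> simply_connected (unit_sphere - K)"
proof
  assume sc: "simply_connected (unit_sphere - K)"
  define n where "n = CARD('n)"
  obtain \<kappa> \<kappa>' where \<kappa>: "homeomorphism (unit_sphere :: (real \<times> (real^'n)) set) K \<kappa> \<kappa>'"
    using iffD1[OF homeomorphic_sym assms(2)] unfolding homeomorphic_def by blast
  obtain e :: "real \<times> (real^'n)" where e: "e \<in> unit_sphere"
    by (rule that[of "SOME i. i \<in> Basis"]) (simp add: norm_Basis SOME_Basis)
  \<comment> \<open>The puncture is taken on \<open>K\<close>: this leaves the complement of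
    \<open>K\<close> untouched and turns \<open>K - {a}\<close> into a copy of
    \<open>real^'n\<close>.\<close>
  define a where "a = \<kappa> e"
  have a: "a \<in> K"
    using \<kappa> e by (auto simp: a_def homeomorphism_def)
  have "unit_sphere - {a} homeomorphic (UNIV :: 'n disk_space set)"
    by (rule homeomorphic_punctured_sphere_affine) (use a assms(1) in \<open>auto simp: aff_dim_UNIV\<close>)
  also have "top_of_set (UNIV :: 'n disk_space set) homeomorphic_space Euclidean_space (n + 2)"
    using homeomorphic_subspace_Euclidean_space_dim[of "UNIV :: 'n disk_space set"]
    by (simp add: n_def)
  then have "(UNIV :: 'n disk_space set) homeomorphic {x::nat \<Rightarrow> real. \<forall>i\<ge>n + 2. x i = 0}"
    unfolding Euclidean_space_top_of_set by (simp only: homeomorphic_space_iff_homeomorphic)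
  finally obtain \<psi> \<psi>' where \<psi>: "homeomorphism (unit_sphere - {a}) {x::nat \<Rightarrow> real. \<forall>i\<ge>n + 2. x i = 0} \<psi> \<psi>'"
    (is "homeomorphism _ ?E _ _")
    unfolding homeomorphic_def by blast
  define S where "S = \<psi> ` (K - {a})"
  have Ksub: "K - {a} \<subseteq> unit_sphere - {a}"
    using assms(1) by auto
  have "compact K"
    using \<kappa> by (metis compact_sphere homeomorphism_def compact_continuous_image)
  then have clK: "closedin (top_of_set (unit_sphere - {a})) (K - {a})"
    using Ksub by (auto simp: closedin_closed intro!: exI[of _ K] compact_imp_closed)
  have clS: "closedin (Euclidean_space (n + 2)) S"
    unfolding S_def Euclidean_space_top_of_set
    using homeomorphism_imp_closed_map[OF \<psi> clK] .
  have cT: "closedin (Euclidean_space (n + 2)) (topspace (Euclidean_space n))"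
    using closedin_Euclidean_space[of n] unfolding Euclidean_space_def[of "n+2"]
    by (intro closedin_subset_topspace) (auto simp: topspace_Euclidean_space)
  have "S homeomorphic (K - {a})"
    by (rule iffD1[OF homeomorphic_sym]) (auto simp: homeomorphic_def S_def
        intro: homeomorphism_of_subsets[OF \<psi> Ksub subset_refl refl])
  also have "(K - {a}) homeomorphic (unit_sphere - {e})"
  proof -
    have "\<kappa> ` (unit_sphere - {e}) = K - {a}"
      using inj_on_image_set_diff[OF inj_on_inverseI, of unit_sphere \<kappa>' \<kappa> unit_sphere "{e}"] \<kappa> e
      by (auto simp: a_def homeomorphism_def)
    then show ?thesis
      using homeomorphism_of_subsets[OF \<kappa> Diff_subset Diff_subset]
      by - (subst homeomorphic_sym, unfold homeomorphic_def, blast)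
  qed
  also have "(unit_sphere - {e}) homeomorphic (UNIV :: (real^'n) set)"
    by (rule homeomorphic_punctured_sphere_affine) (use e in \<open>auto simp: aff_dim_UNIV\<close>)
  also have "top_of_set (UNIV :: (real^'n) set) homeomorphic_space Euclidean_space n"
    using homeomorphic_subspace_Euclidean_space_dim[of "UNIV :: (real^'n) set"]
    by (simp add: n_def)
  then have "(UNIV :: (real^'n) set) homeomorphic {x::nat \<Rightarrow> real. \<forall>i\<ge>n. x i = 0}"
    unfolding Euclidean_space_top_of_set by (simp only: homeomorphic_space_iff_homeomorphic)
  finally have ST: "S homeomorphic {x::nat \<Rightarrow> real. \<forall>i\<ge>n. x i = 0}" .
  have "S \<subseteq> ?E"
    using closedin_subset[OF clS] by (simp add: topspace_Euclidean_space)
  then have "subtopology (Euclidean_space (n+2)) S homeomorphic_space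
      subtopology (Euclidean_space (n+2)) (topspace (Euclidean_space n))"
    using ST by (simp add: Euclidean_space_top_of_set subtopology_subtopology Int_absorb1 Collect_mono)
  then have "homology_group 1 (subtopology (Euclidean_space (n+2)) (topspace (Euclidean_space (n+2)) - S))
      \<cong> homology_group 1 (subtopology (Euclidean_space (n+2))
          (topspace (Euclidean_space (n+2)) - topspace (Euclidean_space n)))"
    by (intro isomorphic_homology_groups_Euclidean_complements clS cT)
  moreover have "homology_group 1 (subtopology (Euclidean_space (n+2)) (topspace (Euclidean_space (n+2)) - S))
      \<cong> homology_group 1 (top_of_set (unit_sphere - K))"
  proof (rule homeomorphic_space_imp_isomorphic_homology_groups)
    have "\<psi> ` (unit_sphere - K) = ?E - S"
    proof -
      have "inj_on \<psi> (unit_sphere - {a})" "\<psi> ` (unit_sphere - {a}) = ?E"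
        using \<psi> by (auto simp: homeomorphism_def intro: inj_on_inverseI)
      moreover have "unit_sphere - K = (unit_sphere - {a}) - (K - {a})"
        using a by auto
      ultimately show ?thesis
        unfolding S_def using inj_on_image_set_diff[of \<psi> "unit_sphere - {a}" "unit_sphere - {a}" "K - {a}"] Ksub
        by auto
    qed
    then have "homeomorphism (unit_sphere - K) (?E - S) \<psi> \<psi>'"
      using homeomorphism_of_subsets[OF \<psi>, of "unit_sphere - K" "?E - S"] a by auto
    then have "(?E - S) homeomorphic (unit_sphere - K)"
      by - (subst homeomorphic_sym, auto simp: homeomorphic_def)
    then show "subtopology (Euclidean_space (n+2)) (topspace (Euclidean_space (n+2)) - S)
        homeomorphic_space top_of_set (unit_sphere - K)"
      by (simp add: Euclidean_space_top_of_set subtopology_subtopology Int_absorb1)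
  qed
  ultimately have "trivial_group (homology_group 1 (subtopology (Euclidean_space (n+2))
          (topspace (Euclidean_space (n+2)) - topspace (Euclidean_space n))))"
    using simply_connected_imp_trivial_homology_group_1[OF sc]
    by (metis group_relative_homology_group isomorphic_group_triviality)
  then show False
    using nontrivial_homology_codim_2_complement by blast
qed

section \<open>Spaces dominated by the punctured plane\<close>

text \<open>The image is a nonzero subgroup of the integers, so it consists of the multiples of its
  least positive element \<open>d\<close>; dividing by \<open>d\<close> makes the embedding
  surjective.\<close>

lemma iso_integer_group_of_embedding:
  fixes h :: "'a \<Rightarrow> int"
  assumes G: "group G" and h: "h \<in> hom G integer_group" and inj: "inj_on h (carrier G)"
    and a: "a \<in> carrier G" "h a \<noteq> 0"
  shows "G \<cong> integer_group"
proof -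
  interpret group_hom G integer_group h
    using G h by (simp add: group_hom_def group_hom_axioms_def)
  define P where "P n \<longleftrightarrow> 0 < n \<and> (\<exists>x\<in>carrier G. h x = int n)" for n
  have "P (nat \<bar>h a\<bar>)"
  proof (cases "h a > 0")
    case True
    with a show ?thesis by (auto simp: P_def)
  next
    case False
    have "h (inv\<^bsub>G\<^esub> a) = - h a" "inv\<^bsub>G\<^esub> a \<in> carrier G"
      using a by (simp_all add: hom_inv)
    with a False show ?thesis by (auto simp: P_def intro!: bexI[of _ "inv\<^bsub>G\<^esub> a"])
  qed
  define d where "d = (LEAST n. P n)"
  have "P d"
    unfolding d_def by (rule LeastI) fact
  then obtain y where y: "y \<in> carrier G" "h y = int d" and d: "d > 0"
    by (auto simp: P_def)
  have pow: "h (y [^]\<^bsub>G\<^esub> m) = m * int d" "y [^]\<^bsub>G\<^esub> m \<in> carrier G" for m :: int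
    using hom_int_pow[OF y(1), of m] y by (simp_all add: G.int_pow_closed)
  have dvd: "int d dvd h x" if x: "x \<in> carrier G" for x
  proof (rule ccontr)
    assume "\<not> int d dvd h x"
    define z where "z = x \<otimes>\<^bsub>G\<^esub> y [^]\<^bsub>G\<^esub> (- (h x div int d))"
    have z: "z \<in> carrier G" "h z = h x mod int d"
      using x pow(2) by (simp_all add: z_def pow(1) minus_div_mult_eq_mod)
    have "0 < h x mod int d" "h x mod int d < int d"
      using \<open>\<not> int d dvd h x\<close> d by (auto simp: dvd_eq_mod_eq_0 order_le_neq_trans)
    then have "P (nat (h x mod int d))" "nat (h x mod int d) < d"
      using z by (auto simp: P_def)
    then show False
      using not_less_Least d_def by blast
  qed
  have "(\<lambda>x. h x div int d) \<in> iso G integer_group"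
    unfolding iso_def bij_betw_def
  proof (intro CollectI conjI)
    show "(\<lambda>x. h x div int d) \<in> hom G integer_group"
      by (rule homI) (use dvd in \<open>auto simp: div_plus_div_distrib_dvd_left\<close>)
    show "inj_on (\<lambda>x. h x div int d) (carrier G)"
      by (rule inj_onI) (metis dvd dvd_div_mult_self inj inj_onD)
    have "m \<in> (\<lambda>x. h x div int d) ` carrier G" for m
      using pow[of m] d by (intro image_eqI[of _ _ "y [^]\<^bsub>G\<^esub> m"]) auto
    then show "(\<lambda>x. h x div int d) ` carrier G = carrier integer_group"
      by auto
  qed
  then show ?thesis
    unfolding is_iso_def by blast
qed

text \<open>The winding number of \<open>\<alpha> \<circ> p\<close> embeds the fundamental group into the integers: it detects whether
  \<open>\<alpha> \<circ> p\<close>, and hence \<open>\<beta> \<circ> \<alpha> \<circ> p\<close>, is freely null-homotopic, and no base point has to be tracked.\<close>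

proposition fundamental_group_dominated_by_punctured_plane:
  fixes E :: "'a::real_normed_vector set" and \<alpha> :: "'a \<Rightarrow> complex" and \<beta> :: "complex \<Rightarrow> 'a"
  assumes b: "b \<in> E"
    and \<alpha>: "continuous_on E \<alpha>" "\<alpha> \<in> E \<rightarrow> - {0}"
    and \<beta>: "continuous_on (- {0}) \<beta>" "\<beta> \<in> - {0} \<rightarrow> E"
    and hom: "homotopic_with_canon (\<lambda>_. True) E E (\<beta> \<circ> \<alpha>) id"
  shows "fundamental_group E b \<cong> integer_group \<or> simply_connected E"
proof -
  define loop where "loop p \<longleftrightarrow> path p \<and> path_image p \<subseteq> E \<and> pathfinish p = pathstart p" for p
  \<comment> \<open>The winding number of a closed path is an integer inside the complex numbers;
    the floor of its real part only changes the type.\<close>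
  define w where "w p = \<lfloor>Re (winding_number (\<alpha> \<circ> p) 0)\<rfloor>" for p
  have \<alpha>p: "path (\<alpha> \<circ> p)" "path_image (\<alpha> \<circ> p) \<subseteq> - {0}" if "path p" "path_image p \<subseteq> E" for p
    using that \<alpha> continuous_on_subset by (auto intro!: path_continuous_image simp: path_image_compose) blast+
  have w: "winding_number (\<alpha> \<circ> p) 0 = of_int (w p)" if "loop p" for p
  proof -
    have "winding_number (\<alpha> \<circ> p) 0 \<in> \<int>"
      using that \<alpha>p[of p] by (intro integer_winding_number) (auto simp: loop_def pathfinish_compose pathstart_compose)
    then show ?thesis
      by (auto simp: w_def elim!: Ints_cases)
  qed
  have w_hom: "w p = w q" if "homotopic_loops E p q" for p q
    unfolding w_def
    using winding_number_homotopic_loops homotopic_loops_continuous_image[OF that \<alpha>] by metis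
  have w_null: "homotopic_paths E p (linepath (pathstart p) (pathstart p))" if p: "loop p" "w p = 0" for p
  proof -
    have "\<exists>a. homotopic_loops (- {0}) (\<alpha> \<circ> p) (\<lambda>t. a)"
      using p \<alpha>p[of p] w[OF p(1)]
      by (subst winding_number_homotopic_loops_null_eq[symmetric])
         (auto simp: loop_def pathfinish_compose pathstart_compose)
    then obtain a where "homotopic_loops (- {0}) (\<alpha> \<circ> p) (\<lambda>t. a)" by blast
    then have "homotopic_loops E (\<beta> \<circ> (\<alpha> \<circ> p)) (\<beta> \<circ> (\<lambda>t. a))"
      by (rule homotopic_loops_continuous_image) fact+
    \<comment> \<open>Composed with \<open>p\<close>, a homotopy of maps gives a closed path at
      every time because \<open>p\<close> is closed. The end point may travel, so only a free
      homotopy results.\<close>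
    moreover have "homotopic_loops E (\<beta> \<circ> \<alpha> \<circ> p) (id \<circ> p)"
      unfolding homotopic_loops_def
    proof (rule homotopic_with_compose_continuous_right)
      show "homotopic_with_canon (\<lambda>f. pathfinish (f \<circ> p) = pathstart (f \<circ> p)) E E (\<beta> \<circ> \<alpha>) id"
        by (rule homotopic_with_mono[OF hom])
           (use p in \<open>auto simp: loop_def pathfinish_def pathstart_def\<close>)
    qed (use p in \<open>auto simp: loop_def path_def path_image_def\<close>)
    ultimately have "homotopic_loops E p (\<lambda>t. \<beta> a)"
      by (auto simp: o_def id_def intro: homotopic_loops_trans homotopic_loops_sym)
    moreover have "(\<lambda>t. \<beta> a) = linepath (\<beta> a) (\<beta> a)"
      by (auto simp: linepath_def algebra_simps)
    ultimately show ?thesis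
      using homotopic_loops_imp_homotopic_paths_null by metis
  qed
  \<comment> \<open>The image of the punctured plane is path connected, and the track of the
    homotopy links each \<open>x\<close> to \<open>\<beta> (\<alpha> x)\<close>.\<close>
  have pc: "path_connected E"
  proof -
    have "path_connected (\<beta> ` (- {0}))"
      by (rule path_connected_continuous_image[OF \<beta>(1)])
         (simp add: path_connected_punctured_universe)
    moreover have "\<beta> ` (- {0}) \<subseteq> E"
      using \<beta>(2) by auto
    moreover have "path_component E (\<beta> (\<alpha> x)) x" if x: "x \<in> E" for x
    proof -
      obtain h where h: "continuous_on ({0..1::real} \<times> E) h" "h \<in> ({0..1} \<times> E) \<rightarrow> E"
        "h (0, x) = \<beta> (\<alpha> x)" "h (1, x) = x"
        using hom x by (auto simp: homotopic_with o_def)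
      have "path (\<lambda>t. h (t, x))"
        unfolding path_def
        by (rule continuous_on_compose2[OF h(1)]) (use x in \<open>auto intro!: continuous_intros\<close>)
      then show ?thesis
        unfolding path_component_def
        using h x by (intro exI[of _ "\<lambda>t. h (t, x)"]) (auto simp: path_image_def pathstart_def pathfinish_def)
    qed
    moreover have "\<alpha> x \<in> - {0}" if "x \<in> E" for x
      using that \<alpha>(2) by auto
    ultimately have *: "path_component E (\<beta> (\<alpha> x)) x" "path_component E (\<beta> (\<alpha> x)) (\<beta> (\<alpha> y))"
      if "x \<in> E" "y \<in> E" for x y
      using that unfolding path_connected_component
      by (blast, meson imageI path_component_of_subset)
    show ?thesis
      unfolding path_connected_component
      using * by (meson path_component_sym path_component_trans)
  qed
  show ?thesis
  proof (cases "\<exists>p. loop p \<and> w p \<noteq> 0")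
    case False
    then have "simply_connected E"
      unfolding simply_connected_eq_contractible_path
      using pc w_null unfolding loop_def by blast
    then show ?thesis ..
  next
    case True
    then obtain p0 where p0: "loop p0" "w p0 \<noteq> 0" by blast
    obtain g where g: "path g" "path_image g \<subseteq> E" "pathstart g = b" "pathfinish g = pathstart p0"
      using pc b p0 unfolding path_connected_def loop_def by (meson pathstart_in_path_image subsetD)
    \<comment> \<open>Conjugation by \<open>g\<close> moves \<open>p0\<close> to the base point
      within its free homotopy class, so the winding number stays nonzero.\<close>
    define p1 where "p1 = g +++ p0 +++ reversepath g"
    have p1: "p1 \<in> loops_at E b"
      using p0 g by (auto simp: p1_def loops_at_def loop_def path_image_join)
    have wp1: "w p1 \<noteq> 0"
      using w_hom[OF homotopic_loops_conjugate[OF g(1) _ g(2)]] p0 g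
      by (auto simp: p1_def loop_def)
    have la: "loop p" if "p \<in> loops_at E b" for p
      using that by (auto simp: loops_at_def loop_def)
    let ?G = "fundamental_group E b"
    define \<psi> where "\<psi> A = w (SOME p. p \<in> A)" for A
    have \<psi>: "\<psi> (path_class E p) = w p" if p: "p \<in> loops_at E b" for p
    proof -
      have "p \<in> path_class E p"
        using p by (auto simp: path_class_def loops_at_def)
      then have "(SOME q. q \<in> path_class E p) \<in> path_class E p"
        by (rule someI[of "\<lambda>q. q \<in> path_class E p"])
      then have *: "homotopic_paths E p (SOME q. q \<in> path_class E p)"
        by (simp add: path_class_def)
      show ?thesis
        unfolding \<psi>_def
        by (rule w_hom[symmetric], rule homotopic_paths_imp_homotopic_loops[OF *])
           (use p homotopic_paths_imp_pathfinish[OF *] in \<open>auto simp: loops_at_def\<close>)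
    qed
    have w_join: "w (p +++ q) = w p + w q" if pq: "p \<in> loops_at E b" "q \<in> loops_at E b" for p q
    proof -
      have "winding_number (\<alpha> \<circ> (p +++ q)) 0 = winding_number (\<alpha> \<circ> p) 0 + winding_number (\<alpha> \<circ> q) 0"
        unfolding path_compose_join
        by (rule winding_number_join)
           (use pq \<alpha>p[of p] \<alpha>p[of q] in \<open>auto simp: loops_at_def pathfinish_compose pathstart_compose\<close>)
      then have "(of_int (w (p +++ q)) :: complex) = of_int (w p + w q)"
        using w[OF la[OF loops_at_join[OF pq]]] w[OF la[OF pq(1)]] w[OF la[OF pq(2)]] by simp
      then show ?thesis
        by (simp only: of_int_eq_iff)
    qed
    have car: "carrier ?G = path_class E ` loops_at E b"
      by (simp add: fundamental_group_def)
    have grp: "group ?G"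
      by (rule group_fundamental_group[OF b])
    have \<psi>hom: "\<psi> \<in> hom ?G integer_group"
      by (rule homI) (auto simp: car path_class_mult \<psi> w_join loops_at_join)
    interpret \<psi>: group_hom ?G integer_group \<psi>
      using grp \<psi>hom by (simp add: group_hom_def group_hom_axioms_def)
    have "inj_on \<psi> (carrier ?G)"
    proof (rule \<psi>.inj_iff_trivial_ker[THEN iffD2], rule equalityI)
      show "kernel ?G integer_group \<psi> \<subseteq> {\<one>\<^bsub>?G\<^esub>}"
      proof
        fix A assume "A \<in> kernel ?G integer_group \<psi>"
        then obtain p where p: "p \<in> loops_at E b" "A = path_class E p" "w p = 0"
          by (auto simp: kernel_def car \<psi>)
        have "homotopic_paths E p (linepath b b)"
          using w_null[OF la[OF p(1)] p(3)] p(1) by (simp add: loops_at_def)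
        then have "A = path_class E (linepath b b)"
          using p path_class_eq_iff by blast
        also have "linepath b b = (\<lambda>_. b)"
          by (auto simp: linepath_def algebra_simps)
        finally show "A \<in> {\<one>\<^bsub>?G\<^esub>}"
          by (simp add: fundamental_group_def)
      qed
    qed (auto simp: kernel_def \<psi>.hom_one)
    then have "?G \<cong> integer_group"
      using iso_integer_group_of_embedding[OF grp \<psi>hom, of "path_class E p1"] p1 wp1
      by (simp add: car \<psi>)
    then show ?thesis ..
  qed
qed

section \<open>Inversions and chordal distance\<close>

lemma round_ball_iff: "x \<in> round_ball c r \<longleftrightarrow> norm x = 1 \<and> dist c x \<le> r"
  by (auto simp: round_ball_def)

lemma dist_unit_sphere:
  fixes x y :: "'a::real_inner"
  assumes "norm x = 1" "norm y = 1"
  shows "(dist x y)\<^sup>2 = 2 - 2 * (x \<bullet> y)"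
  using assms by (simp add: dist_norm power2_norm_eq_inner inner_diff_left inner_diff_right norm_eq_1 inner_commute)

text \<open>For unit vectors and \<open>t = 1 - r\<^sup>2 / 2\<close> different from 0, this is
  \<open>t\<^sup>2\<close> times the squared distance of \<open>x\<close> from
  \<open>c /\<^sub>R t\<close>, the centre of the Euclidean inversion that
  \<open>inversion c r\<close> restricts. This form remains meaningful for \<open>t = 0\<close>,
  where the inversion is a reflection.\<close>

definition inversion_denom :: "'a::euclidean_space \<Rightarrow> real \<Rightarrow> 'a \<Rightarrow> real" where
  "inversion_denom c r x = 1 + (1 - r\<^sup>2 / 2)\<^sup>2 - 2 * (1 - r\<^sup>2 / 2) * (x \<bullet> c)"

lemma inversion_denom:
  fixes c x :: "'a::euclidean_space"
  assumes "norm c = 1" "norm x = 1" "0 < r" "r < 2"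
  defines "t \<equiv> 1 - r\<^sup>2 / 2"
  shows inversion_denom_pos: "inversion_denom c r x > 0"
    and inversion_denom_scaleR:
      "inversion_denom c r x *\<^sub>R inversion c r x = (1 - t\<^sup>2) *\<^sub>R x - (2 * (x \<bullet> c - t)) *\<^sub>R c"
    and abs_height_less_1: "\<bar>t\<bar> < 1"
proof -
  have "r\<^sup>2 < 2\<^sup>2"
    using assms(3,4) by (intro power_strict_mono) auto
  moreover have "0 < r\<^sup>2"
    using assms(3) by simp
  ultimately show t: "\<bar>t\<bar> < 1"
    unfolding t_def by (simp add: abs_if)
  have "\<bar>x \<bullet> c\<bar> \<le> 1"
    using Cauchy_Schwarz_ineq2[of x c] assms(1,2) by simp
  then have "t * (x \<bullet> c) \<le> \<bar>t\<bar>"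
    using mult_left_le[of "\<bar>x \<bullet> c\<bar>" "\<bar>t\<bar>"] abs_ge_self[of "t * (x \<bullet> c)"] by (simp add: abs_mult)
  moreover have "0 < (1 - \<bar>t\<bar>)\<^sup>2"
    using t by simp
  ultimately show N: "inversion_denom c r x > 0"
    by (simp add: inversion_denom_def t_def power2_eq_square algebra_simps)
  then show "inversion_denom c r x *\<^sub>R inversion c r x = (1 - t\<^sup>2) *\<^sub>R x - (2 * (x \<bullet> c - t)) *\<^sub>R c"
    unfolding inversion_def Let_def t_def[symmetric]
    by (simp add: inversion_denom_def t_def)
qed

text \<open>Both identities come from expanding inner products. The first is conformality: each of
  the two points contributes the factor \<open>(1 - t\<^sup>2) / inversion_denom c r x\<close>. The
  second compares an image with an unmoved point. Its mixed term is positive when both points lie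
  strictly on the same side of the hyperplane cutting out the boundary sphere; this is the source of
  all contraction below.\<close>

lemma dist_inversion:
  fixes c x y :: "'a::euclidean_space"
  assumes "norm c = 1" "norm x = 1" "norm y = 1" "0 < r" "r < 2"
  defines "t \<equiv> 1 - r\<^sup>2 / 2"
  shows dist_inversion_inversion:
      "inversion_denom c r x * inversion_denom c r y * (dist (inversion c r x) (inversion c r y))\<^sup>2 =
       (1 - t\<^sup>2)\<^sup>2 * (dist x y)\<^sup>2"
    and dist_inversion_point:
      "inversion_denom c r x * (dist (inversion c r x) y)\<^sup>2 =
       (1 - t\<^sup>2) * (dist x y)\<^sup>2 + 4 * (y \<bullet> c - t) * (x \<bullet> c - t)"
proof -
  define s u v where "s = x \<bullet> c" and "u = y \<bullet> c" and "v = x \<bullet> y"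
  have cc: "c \<bullet> c = 1" "x \<bullet> x = 1" "y \<bullet> y = 1"
    using assms by (simp_all add: norm_eq_1)
  have N: "inversion_denom c r x = 1 + t\<^sup>2 - 2 * t * s" "inversion_denom c r y = 1 + t\<^sup>2 - 2 * t * u"
    by (simp_all add: inversion_denom_def t_def s_def u_def)
  note X = inversion_denom_scaleR[OF assms(1,2,4,5), folded t_def]
  note Y = inversion_denom_scaleR[OF assms(1,3,4,5), folded t_def]
  have nI: "norm (inversion c r x) = 1" "norm (inversion c r y) = 1"
    using assms by (simp_all add: norm_inversion)
  have "inversion_denom c r x * inversion_denom c r y * (inversion c r x \<bullet> inversion c r y) =
      (inversion_denom c r x *\<^sub>R inversion c r x) \<bullet> (inversion_denom c r y *\<^sub>R inversion c r y)"
    by simp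
  also have "\<dots> = (1 - t\<^sup>2)\<^sup>2 * v - 2 * (1 - t\<^sup>2) * (u - t) * s - 2 * (1 - t\<^sup>2) * (s - t) * u
      + 4 * (s - t) * (u - t)"
    unfolding X Y
    by (simp add: inner_diff_left inner_diff_right cc s_def[symmetric] u_def[symmetric] v_def[symmetric]
        inner_commute[of c x] inner_commute[of c y] inner_commute[of y x])
       (simp add: power2_eq_square algebra_simps)
  finally show "inversion_denom c r x * inversion_denom c r y * (dist (inversion c r x) (inversion c r y))\<^sup>2 =
       (1 - t\<^sup>2)\<^sup>2 * (dist x y)\<^sup>2"
    unfolding dist_unit_sphere[OF nI] dist_unit_sphere[OF assms(2,3)] right_diff_distrib v_def[symmetric]
    by (simp add: N mult.left_commute[of _ 2]) (simp add: power2_eq_square algebra_simps)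
  have "inversion_denom c r x * (inversion c r x \<bullet> y) = (inversion_denom c r x *\<^sub>R inversion c r x) \<bullet> y"
    by simp
  also have "\<dots> = (1 - t\<^sup>2) * v - 2 * (s - t) * u"
    unfolding X
    by (simp add: inner_diff_left s_def[symmetric] u_def v_def inner_commute[of c y])
  finally show "inversion_denom c r x * (dist (inversion c r x) y)\<^sup>2 =
       (1 - t\<^sup>2) * (dist x y)\<^sup>2 + 4 * (y \<bullet> c - t) * (x \<bullet> c - t)"
    unfolding dist_unit_sphere[OF nI(1) assms(3)] dist_unit_sphere[OF assms(2,3)] right_diff_distrib
      v_def[symmetric] s_def[symmetric] u_def[symmetric]
    by (simp add: N mult.left_commute[of _ 2]) (simp add: power2_eq_square algebra_simps)
qed

lemma dist_less_iff_height:
  fixes c x :: "'a::euclidean_space"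
  assumes "norm c = 1" "norm x = 1" "0 < r"
  shows "dist c x < r \<longleftrightarrow> x \<bullet> c > 1 - r\<^sup>2 / 2" "dist c x \<le> r \<longleftrightarrow> x \<bullet> c \<ge> 1 - r\<^sup>2 / 2"
proof -
  have d: "(dist c x)\<^sup>2 = 2 - 2 * (x \<bullet> c)"
    using dist_unit_sphere[OF assms(1,2)] by (simp add: inner_commute)
  have "dist c x < r \<longleftrightarrow> (dist c x)\<^sup>2 < r\<^sup>2" "dist c x \<le> r \<longleftrightarrow> (dist c x)\<^sup>2 \<le> r\<^sup>2"
    using assms(3) power_mono_iff[of "dist c x" r 2] power_mono_iff[of r "dist c x" 2]
    by (auto simp: not_le[symmetric])
  then show "dist c x < r \<longleftrightarrow> x \<bullet> c > 1 - r\<^sup>2 / 2" "dist c x \<le> r \<longleftrightarrow> x \<bullet> c \<ge> 1 - r\<^sup>2 / 2"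
    unfolding d by auto
qed

lemma continuous_on_inversion:
  assumes "norm c = 1" "0 < r" "r < 2"
  shows "continuous_on unit_sphere (inversion c r)"
proof -
  have "1 + (1 - r\<^sup>2 / 2)\<^sup>2 - 2 * (1 - r\<^sup>2 / 2) * (x \<bullet> c) \<noteq> 0" if "norm x = 1" for x
    using inversion_denom_pos[OF assms(1) that assms(2,3)] by (simp add: inversion_denom_def)
  then show ?thesis
    unfolding inversion_def Let_def by (auto intro!: continuous_intros)
qed

text \<open>A point on the boundary sphere is not interior: pushing it away from \<open>c\<close>
  and normalising leaves the ball for arbitrarily small pushes. The bound \<open>r < 2\<close>
  matters, since the whole sphere is its own interior.\<close>

lemma sphere_interior_round_ball:
  fixes c :: "'a::euclidean_space"
  assumes c: "norm c = 1" and r: "0 < r" "r < 2"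
  shows "sphere_interior (round_ball c r) = {x. norm x = 1 \<and> dist c x < r}" (is "?I = ?O")
proof
  have "?O = unit_sphere \<inter> ball c r"
    by auto
  then show "?O \<subseteq> ?I"
    by (intro interior_of_maximal) (auto simp: round_ball_def openin_open)
  show "?I \<subseteq> ?O"
  proof
    fix x assume x: "x \<in> ?I"
    have xB: "norm x = 1" "dist c x \<le> r"
      using subsetD[OF interior_of_subset x] by (auto simp: round_ball_iff)
    define t where "t = 1 - r\<^sup>2 / 2"
    have t: "\<bar>t\<bar> < 1"
      using abs_height_less_1[OF c c r] by (simp add: t_def)
    have False if "\<not> dist c x < r"
    proof -
      have xc: "x \<bullet> c = t"
        using that xB dist_less_iff_height[OF c xB(1) r(1)] by (simp add: t_def)
      obtain T where T: "open T" "?I = unit_sphere \<inter> T"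
        using openin_interior_of[of "top_of_set unit_sphere" "round_ball c r"]
        unfolding openin_open by blast
      define p where "p e = (x - e *\<^sub>R c) /\<^sub>R norm (x - e *\<^sub>R c)" for e :: real
      have "isCont p 0"
        unfolding p_def using xB by (auto intro!: continuous_intros)
      moreover have "p 0 = x"
        using xB by (simp add: p_def)
      ultimately have "\<forall>\<^sub>F e in at 0. p e \<in> T"
        using T x by (auto simp: isCont_def dest: topological_tendstoD)
      then have "\<forall>\<^sub>F e in at_right 0. p e \<in> T"
        using eventually_at_split[of _ "0::real"] by blast
      then obtain b where b: "b > 0" "\<And>e. 0 < e \<Longrightarrow> e < b \<Longrightarrow> p e \<in> T"
        unfolding eventually_at_right_field by auto
      define e where "e = min (b / 2) (1 / 2)"
      have e: "0 < e" "e < b" "e < 1"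
        using b by (auto simp: e_def)
      define n where "n = norm (x - e *\<^sub>R c)"
      have "n \<ge> 1 - e"
        using norm_triangle_ineq2[of x "e *\<^sub>R c"] xB c e by (simp add: n_def)
      then have n0: "n > 0"
        using e by linarith
      have "norm (p e) = 1"
        using n0 by (simp add: p_def n_def)
      then have "p e \<in> round_ball c r"
        using b(2)[OF e(1,2)] T interior_of_subset[of "top_of_set unit_sphere" "round_ball c r"] by auto
      then have "p e \<bullet> c \<ge> t"
        using dist_less_iff_height(2)[OF c \<open>norm (p e) = 1\<close> r(1)] by (simp add: t_def round_ball_iff)
      moreover have "p e \<bullet> c = (t - e) / n"
        using c by (simp add: p_def n_def inner_diff_left xc norm_eq_1 divide_inverse mult.commute)
      ultimately have *: "t * n \<le> t - e"
        using n0 by (simp add: pos_le_divide_eq)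
      \<comment> \<open>The inequality \<open>t * n \<le> t - e\<close> says that the pushed point
        is still in the ball. The sign of \<open>t\<close> decides which bound on \<open>n\<close>
        refutes it: \<open>1 - e * t \<le> n\<close> from Cauchy-Schwarz with \<open>x\<close>, or
        \<open>n \<le> 1 + e\<close> from the triangle inequality.\<close>
      show False
      proof (cases "t \<ge> 0")
        case True
        have "(x - e *\<^sub>R c) \<bullet> x \<le> n"
          using norm_cauchy_schwarz[of "x - e *\<^sub>R c" x] xB by (simp add: n_def)
        then have "1 - e * t \<le> n"
          using xB xc by (simp add: inner_diff_left inner_diff_right norm_eq_1 inner_commute)
        then have "t * (1 - e * t) \<le> t - e"
          using * True by (meson mult_left_mono order_trans)
        then have "e * 1 \<le> e * t\<^sup>2"
          by (simp add: algebra_simps power2_eq_square)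
        then show False
          using e t abs_square_less_1[of t] by simp
      next
        case False
        have "n \<le> 1 + e"
          using norm_triangle_ineq4[of x "e *\<^sub>R c"] xB c e by (simp add: n_def)
        then have "t * (1 + e) \<le> t * n"
          using False by (simp add: mult_left_mono_neg)
        then have "e * 1 \<le> e * (- t)"
          using * by (simp add: algebra_simps)
        then have "1 \<le> - t"
          using e(1) mult_le_cancel_left_pos by blast
        then show False
          using t by simp
      qed
    qed
    then show "x \<in> ?O"
      using xB by blast
  qed
qed

section \<open>Folding the sphere onto the fundamental domain\<close>

lemma continuous_on_finite_closed_cover:
  fixes f :: "'a::topological_space \<Rightarrow> 'b::topological_space"
  assumes "finite I" "\<And>i. i \<in> I \<Longrightarrow> closed (U i)" "S \<subseteq> (\<Union>i\<in>I. U i)"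
    and "\<And>i. i \<in> I \<Longrightarrow> continuous_on (S \<inter> U i) f"
  shows "continuous_on S f"
proof -
  have "continuous_map (top_of_set S) euclidean f"
  proof (rule pasting_lemma_closed[where T = "\<lambda>i. S \<inter> U i" and f = "\<lambda>_. f"])
    show "closedin (top_of_set S) (S \<inter> U i)" if "i \<in> I" for i
      using assms(2)[OF that] by (auto simp: closedin_closed)
    show "continuous_map (subtopology (top_of_set S) (S \<inter> U i)) euclidean f" if "i \<in> I" for i
      using assms(4)[OF that] by (simp add: subtopology_subtopology)
  qed (use assms in auto)
  then show ?thesis by simp
qed

locale disjoint_round_balls =
  fixes k :: nat and c :: "nat \<Rightarrow> 'a::euclidean_space" and r :: "nat \<Rightarrow> real"
  assumes norm_center': "j \<in> {1..k} \<Longrightarrow> norm (c j) = 1"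
    and radius': "j \<in> {1..k} \<Longrightarrow> 0 < r j \<and> r j < 2"
    and disjoint: "disjoint_family_on (\<lambda>j. round_ball (c j) (r j)) {1..k}"
begin

text \<open>Kept opaque so that the simplifier does not dissolve membership of an index into
  inequalities.\<close>

definition ind :: "nat set" where "ind = {1..k}"

lemma norm_center: "j \<in> ind \<Longrightarrow> norm (c j) = 1"
  and radius: "j \<in> ind \<Longrightarrow> 0 < r j \<and> r j < 2"
  using norm_center' radius' by (auto simp: ind_def)

lemma finite_ind [simp]: "finite ind"
  by (simp add: ind_def)

abbreviation bead :: "nat \<Rightarrow> 'a set" where "bead j \<equiv> round_ball (c j) (r j)"
abbreviation inv_in :: "nat \<Rightarrow> 'a \<Rightarrow> 'a" where "inv_in j \<equiv> inversion (c j) (r j)"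
abbreviation wmap :: "nat list \<Rightarrow> 'a \<Rightarrow> 'a" where "wmap \<equiv> word_map c r"
abbreviation stage :: "nat \<Rightarrow> 'a set" where "stage \<equiv> stage_beads k c r"
abbreviation words :: "nat \<Rightarrow> nat list set" where "words \<equiv> admissible_words k"

definition open_bead :: "nat \<Rightarrow> 'a set" where
  "open_bead j = {x. norm x = 1 \<and> dist (c j) x < r j}"

definition fund_domain :: "'a set" where
  "fund_domain = unit_sphere - (\<Union>j\<in>ind. open_bead j)"

text \<open>The choice is among at most one index, because the closed beads are disjoint. They
  overlap \<open>fund_domain\<close> in their boundary spheres, where the inversions are the
  identity, so the pieces can be pasted over a closed cover.\<close>

definition fold_step :: "'a \<Rightarrow> 'a" where
  "fold_step x = (if \<exists>j\<in>ind. x \<in> bead j then inv_in (SOME j. j \<in> ind \<and> x \<in> bead j) x else x)"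

lemma sphere_interior_bead: "j \<in> ind \<Longrightarrow> sphere_interior (bead j) = open_bead j"
  unfolding open_bead_def using norm_center radius by (intro sphere_interior_round_ball) auto

lemma bead_unique: "i \<in> ind \<Longrightarrow> j \<in> ind \<Longrightarrow> x \<in> bead i \<Longrightarrow> x \<in> bead j \<Longrightarrow> i = j"
  using disjoint unfolding disjoint_family_on_def ind_def by blast

lemma open_bead_subset: "open_bead j \<subseteq> bead j"
  by (auto simp: open_bead_def round_ball_iff)

lemma bead_subset: "bead j \<subseteq> unit_sphere"
  by (auto simp: round_ball_def)

lemma norm_inv_in [simp]: "j \<in> ind \<Longrightarrow> norm x = 1 \<Longrightarrow> norm (inv_in j x) = 1"
  using norm_center radius by (intro norm_inversion) auto

lemma inv_in_inv_in [simp]: "j \<in> ind \<Longrightarrow> norm x = 1 \<Longrightarrow> inv_in j (inv_in j x) = x"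
  using norm_center radius by (intro inversion_involution) auto

lemma inv_in_boundary: "j \<in> ind \<Longrightarrow> x \<in> bead j \<Longrightarrow> x \<notin> open_bead j \<Longrightarrow> inv_in j x = x"
  using norm_center radius by (intro inversion_fixes_boundary) (auto simp: round_ball_iff open_bead_def)

lemma inv_in_open_bead_iff: "j \<in> ind \<Longrightarrow> norm x = 1 \<Longrightarrow> inv_in j x \<in> open_bead j \<longleftrightarrow> x \<notin> bead j"
  using norm_center radius inversion_exchanges[of "c j" x "r j"]
  by (auto simp: round_ball_iff open_bead_def)

lemma inv_in_bead_iff: "j \<in> ind \<Longrightarrow> norm x = 1 \<Longrightarrow> inv_in j x \<in> bead j \<longleftrightarrow> x \<notin> open_bead j"
  using inv_in_open_bead_iff[of j "inv_in j x"] by auto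

lemma fold_step_bead: "j \<in> ind \<Longrightarrow> x \<in> bead j \<Longrightarrow> fold_step x = inv_in j x"
  unfolding fold_step_def using bead_unique by (metis (mono_tags, lifting) someI_ex)

lemma fold_step_domain [simp]: "x \<in> fund_domain \<Longrightarrow> fold_step x = x"
proof (cases "\<exists>j\<in>ind. x \<in> bead j")
  case True
  moreover assume "x \<in> fund_domain"
  ultimately show ?thesis
    using inv_in_boundary fold_step_bead by (auto simp: fund_domain_def)
qed (simp add: fold_step_def)

lemma norm_fold_step [simp]: "norm x = 1 \<Longrightarrow> norm (fold_step x) = 1"
  by (metis fold_step_bead fold_step_def norm_inv_in)

lemma norm_fold_pow [simp]: "norm x = 1 \<Longrightarrow> norm ((fold_step ^^ m) x) = 1"
  by (induction m) auto

lemma fold_pow_domain [simp]: "x \<in> fund_domain \<Longrightarrow> (fold_step ^^ m) x = x"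
  by (induction m) auto

lemma domain_or_open_bead: "norm x = 1 \<Longrightarrow> x \<in> fund_domain \<or> (\<exists>j\<in>ind. x \<in> open_bead j)"
  by (auto simp: fund_domain_def)

lemma continuous_on_inv_in: "j \<in> ind \<Longrightarrow> continuous_on unit_sphere (inv_in j)"
  using norm_center radius by (intro continuous_on_inversion) auto

lemma center_in_bead: "j \<in> ind \<Longrightarrow> c j \<in> bead j"
  using norm_center radius by (auto simp: round_ball_iff less_imp_le)

lemma closed_bead: "closed (bead j)"
  by (simp add: round_ball_def closed_Int)

lemma compact_domain: "compact fund_domain"
proof -
  have "fund_domain = unit_sphere - (\<Union>j\<in>ind. ball (c j) (r j))"
    by (auto simp: fund_domain_def open_bead_def)
  then show ?thesis
    by (simp add: compact_diff open_UN)
qed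

lemma continuous_on_fold_step: "continuous_on unit_sphere fold_step"
proof (rule continuous_on_finite_closed_cover[of "{..k}" "\<lambda>j. if j = 0 then fund_domain else bead j"])
  \<comment> \<open>Beads are numbered from 1, which leaves the index 0 for the fundamental
    domain.\<close>
  show "closed (if i = 0 then fund_domain else bead i)" for i
    using compact_domain closed_bead by (simp add: compact_imp_closed)
  show "unit_sphere \<subseteq> (\<Union>j\<in>{..k}. if j = 0 then fund_domain else bead j)"
  proof
    fix x :: 'a assume "x \<in> unit_sphere"
    then consider "x \<in> fund_domain" | j where "j \<in> ind" "x \<in> open_bead j"
      using domain_or_open_bead[of x] by auto
    then show "x \<in> (\<Union>j\<in>{..k}. if j = 0 then fund_domain else bead j)"
    proof cases
      case (2 j)
      then show ?thesis
        using open_bead_subset by (intro UN_I[of j]) (auto simp: ind_def)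
    qed auto
  qed
  show "continuous_on (unit_sphere \<inter> (if i = 0 then fund_domain else bead i)) fold_step" if "i \<in> {..k}" for i
  proof (cases "i = 0")
    case True
    have "continuous_on fund_domain fold_step"
      by (rule continuous_on_eq[OF continuous_on_id]) simp
    then show ?thesis
      by (rule continuous_on_subset) (use True in auto)
  next
    case False
    then have i: "i \<in> ind"
      using that by (auto simp: ind_def)
    have "continuous_on (bead i) fold_step"
      using fold_step_bead[OF i]
      by (intro continuous_on_eq[OF continuous_on_subset[OF continuous_on_inv_in[OF i] bead_subset]]) auto
    with False show ?thesis
      by (auto intro: continuous_on_subset)
  qed
qed auto

lemma continuous_on_fold_pow: "continuous_on unit_sphere (fold_step ^^ m)"
proof (induction m)
  case (Suc m)
  have "continuous_on unit_sphere (fold_step \<circ> fold_step ^^ m)"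
    by (rule continuous_on_compose[OF Suc continuous_on_subset[OF continuous_on_fold_step]]) auto
  then show ?case by simp
qed auto

section \<open>Words of inversions and the beads of all stages\<close>

lemma wmap_Nil [simp]: "wmap [] = id"
  and wmap_Cons [simp]: "wmap (j # w) x = inv_in j (wmap w x)"
  by (simp_all add: word_map_def)

lemma wmap_append: "wmap (v @ w) x = wmap v (wmap w x)"
  by (induction v) auto

lemma norm_wmap: "set w \<subseteq> ind \<Longrightarrow> norm x = 1 \<Longrightarrow> norm (wmap w x) = 1"
  by (induction w) auto

lemma continuous_on_wmap: "set w \<subseteq> ind \<Longrightarrow> continuous_on unit_sphere (wmap w)"
proof (induction w)
  case (Cons j w)
  have "wmap (j # w) = inv_in j \<circ> wmap w"
    by auto
  moreover have "continuous_on unit_sphere (inv_in j \<circ> wmap w)"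
    using Cons norm_wmap[of w]
    by (intro continuous_on_compose continuous_on_subset[OF continuous_on_inv_in[of j]]) auto
  ultimately show ?case by simp
qed (auto simp: id_def)

text \<open>An inversion throws every point outside its open bead into its closed bead. In an
  admissible word, each further letter meets a point in the bead of a different letter, so this
  applies at every step, and folding deletes the letters again from the left.\<close>

lemma fold_pow_wmap:
  assumes "w \<noteq> []" "set w \<subseteq> ind" "distinct_adj w" "norm z = 1" "z \<notin> open_bead (last w)"
  shows "wmap w z \<in> bead (hd w) \<and> (fold_step ^^ length w) (wmap w z) = z"
  using assms
proof (induction w)
  case (Cons j w)
  have j: "j \<in> ind" using Cons.prems by simp
  show ?case
  proof (cases w)
    case Nil
    then show ?thesis
      using Cons.prems inv_in_bead_iff[OF j] fold_step_bead[OF j] by auto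
  next
    case (Cons i v)
    have IH: "wmap w z \<in> bead (hd w)" "(fold_step ^^ length w) (wmap w z) = z"
      using Cons Cons.IH Cons.prems by auto
    have n: "norm (wmap w z) = 1"
      using Cons.prems by (intro norm_wmap) auto
    have "wmap w z \<notin> bead j"
      using IH(1) Cons Cons.prems bead_unique[of j i] by auto
    then have b: "inv_in j (wmap w z) \<in> bead j"
      using inv_in_bead_iff[OF j n] open_bead_subset by auto
    then have "fold_step (inv_in j (wmap w z)) = wmap w z"
      using fold_step_bead[OF j b] j n by simp
    then show ?thesis
      using b IH by (simp add: funpow_swap1)
  qed
qed simp

lemma words_iff: "w \<in> words m \<longleftrightarrow> length w = m \<and> set w \<subseteq> ind \<and> distinct_adj w"
  by (auto simp: admissible_words_def ind_def)

lemma finite_words: "finite (words m)"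
  by (rule finite_subset[OF _ finite_lists_length_eq[of ind m]]) (auto simp: words_iff)

lemma words_Suc: "w \<in> words (Suc m) \<Longrightarrow> w \<noteq> [] \<and> last w \<in> ind"
  using last_in_set[of w] by (cases "w = []") (auto simp: words_iff)

text \<open>A bead is the image of its exterior under its own inversion. Absorbing this inversion
  writes a bead of stage \<open>m\<close> as the image of an exterior under a full word of length
  \<open>m + 1\<close>, the form to which \<open>fold_pow_wmap\<close> applies.\<close>

lemma stage_eq: "stage m = (\<Union>w\<in>words (Suc m). wmap w ` (unit_sphere - open_bead (last w)))"
proof -
  have "wmap (butlast w) ` bead (last w) = wmap w ` (unit_sphere - open_bead (last w))"
    if "w \<in> words (Suc m)" for w
  proof -
    have w: "w \<noteq> []" "last w \<in> ind"
      using words_Suc[OF that] by auto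
    have "wmap w x = wmap (butlast w) (inv_in (last w) x)" for x
      using wmap_append[of "butlast w" "[last w]"] w by simp
    moreover have "bead (last w) = inv_in (last w) ` (unit_sphere - open_bead (last w))"
    proof -
      have "x \<in> inv_in (last w) ` (unit_sphere - open_bead (last w))" if "x \<in> bead (last w)" for x
        using that w(2) inv_in_open_bead_iff[OF w(2), of x]
        by (intro image_eqI[of _ _ "inv_in (last w) x"]) (auto simp: round_ball_iff)
      then show ?thesis
        using inv_in_bead_iff[OF w(2)] by auto
    qed
    ultimately show ?thesis
      by (simp add: image_image)
  qed
  then show ?thesis
    unfolding stage_beads_def by simp
qed

lemma stageE:
  assumes "y \<in> stage m"
  obtains w z where "w \<in> words (Suc m)" "norm z = 1" "z \<notin> open_bead (last w)" "y = wmap w z"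
  using assms unfolding stage_eq by auto

lemma stageI: "w \<in> words (Suc m) \<Longrightarrow> norm z = 1 \<Longrightarrow> z \<notin> open_bead (last w) \<Longrightarrow> wmap w z \<in> stage m"
  unfolding stage_eq by (intro UN_I imageI) auto

lemma compact_stage: "compact (stage m)"
  unfolding stage_eq
proof (intro compact_UN finite_words compact_continuous_image)
  fix w assume w: "w \<in> words (Suc m)"
  show "continuous_on (unit_sphere - open_bead (last w)) (wmap w)"
    using w by (intro continuous_on_subset[OF continuous_on_wmap]) (auto simp: words_iff)
  have "unit_sphere - open_bead (last w) = unit_sphere - ball (c (last w)) (r (last w))"
    by (auto simp: open_bead_def)
  then show "compact (unit_sphere - open_bead (last w))"
    by (simp add: compact_diff)
qed

text \<open>By induction, prefixing a letter. The point \<open>y\<close> must lie in some open bead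
  \<open>i\<close>, as folding would never move it otherwise. Its image lies outside bead
  \<open>i\<close>, hence the word found for the image does not begin with \<open>i\<close> and
  \<open>i\<close> may be put in front.\<close>

lemma open_bead_imp_stage:
  assumes "norm y = 1" "j \<in> ind" "(fold_step ^^ m) y \<in> open_bead j"
  shows "y \<in> stage m"
  using assms
proof (induction m arbitrary: y)
  case 0
  have "inv_in j y \<notin> open_bead j"
    using 0 inv_in_open_bead_iff[of j y] open_bead_subset by auto
  then show ?case
    using 0 stageI[of "[j]" 0 "inv_in j y"] by (simp add: words_iff)
next
  case (Suc m)
  have "y \<notin> fund_domain"
  proof
    assume "y \<in> fund_domain"
    then have "(fold_step ^^ Suc m) y = y"
      by (rule fold_pow_domain)
    with \<open>y \<in> fund_domain\<close> Suc.prems show False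
      by (auto simp: fund_domain_def)
  qed
  then obtain i where i: "i \<in> ind" "y \<in> open_bead i"
    using Suc.prems domain_or_open_bead by blast
  then have f: "fold_step y = inv_in i y"
    using fold_step_bead open_bead_subset by blast
  then have "inv_in i y \<in> stage m"
    using Suc.IH[of "inv_in i y"] Suc.prems i by (simp add: funpow_swap1)
  then obtain w z where w: "w \<in> words (Suc m)" "norm z = 1" "z \<notin> open_bead (last w)" "inv_in i y = wmap w z"
    by (rule stageE)
  have "w \<noteq> []"
    using w by (auto simp: words_iff)
  have "wmap w z \<in> bead (hd w)"
    using fold_pow_wmap[OF \<open>w \<noteq> []\<close>] w by (auto simp: words_iff)
  moreover have "inv_in i y \<notin> bead i"
    using i Suc.prems inv_in_open_bead_iff[of i "inv_in i y"] by simp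
  ultimately have "i \<noteq> hd w"
    using w(4) by metis
  then have "i # w \<in> words (Suc (Suc m))"
    using w(1) i \<open>w \<noteq> []\<close> by (cases w) (auto simp: words_iff)
  moreover have "y = wmap (i # w) z"
    using Suc.prems i w(4)[symmetric] by simp
  ultimately show ?case
    using stageI[of "i # w" "Suc m" z] w \<open>w \<noteq> []\<close> by simp
qed

lemma fold_pow_in_domain: "norm y = 1 \<Longrightarrow> y \<notin> stage m \<Longrightarrow> (fold_step ^^ m) y \<in> fund_domain"
  using domain_or_open_bead[of "(fold_step ^^ m) y"] open_bead_imp_stage by auto

lemma fold_pow_stable:
  assumes "norm y = 1" "y \<notin> stage m" "m \<le> n"
  shows "(fold_step ^^ n) y = (fold_step ^^ m) y"
proof -
  have "(fold_step ^^ n) y = (fold_step ^^ (n - m)) ((fold_step ^^ m) y)"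
    using assms(3) by (simp flip: funpow_add comp_apply[of "_ ^^ _"])
  then show ?thesis
    using fold_pow_in_domain[OF assms(1,2)] by simp
qed

text \<open>Folding deletes the first letter of a word of length at least 2, which is an admissible
  word one letter shorter.\<close>

lemma fold_step_stage: "y \<in> stage (Suc m) \<Longrightarrow> fold_step y \<in> stage m"
proof -
  assume "y \<in> stage (Suc m)"
  then obtain w z where w: "w \<in> words (Suc (Suc m))" "norm z = 1" "z \<notin> open_bead (last w)" "y = wmap w z"
    by (rule stageE)
  then obtain j v where wv: "w = j # v" "v \<noteq> []"
    by (auto simp: words_iff length_Suc_conv)
  have v: "v \<in> words (Suc m)" "j \<in> ind" "hd v \<noteq> j" "hd v \<in> ind"
    using w(1) wv by (cases v; auto simp: words_iff)+
  have "wmap v z \<in> bead (hd v)"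
    using fold_pow_wmap[of v z] v w wv by (auto simp: words_iff)
  then have "wmap v z \<notin> bead j"
    using bead_unique[OF v(2,4)] v(3) by blast
  moreover have n: "norm (wmap v z) = 1"
    using v w(2) by (intro norm_wmap) (auto simp: words_iff)
  ultimately have "inv_in j (wmap v z) \<in> bead j"
    using inv_in_bead_iff[OF v(2) n] open_bead_subset by auto
  then have "fold_step y = wmap v z"
    using fold_step_bead[OF v(2)] w(4) wv n v(2) by simp
  then show ?thesis
    using stageI[OF v(1) w(2)] w(3) wv by simp
qed

text \<open>The second inversion acts on a point of another closed bead, so its image is in the open
  bead. Stage 0 would not do: the boundary spheres of the beads belong to both sets.\<close>

lemma domain_Int_stage_1: "fund_domain \<inter> stage 1 = {}"
proof -
  have False if y: "y \<in> fund_domain" "y \<in> stage 1" for y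
  proof -
    obtain w z where w: "w \<in> words 2" "norm z = 1" "z \<notin> open_bead (last w)" "y = wmap w z"
      using y(2) by (auto elim!: stageE simp: numeral_2_eq_2)
    then obtain i j where ij: "w = [i, j]" "i \<in> ind" "j \<in> ind" "i \<noteq> j"
      by (auto simp: words_iff numeral_2_eq_2 length_Suc_conv)
    have "inv_in j z \<in> bead j"
      using w ij inv_in_bead_iff by simp
    then have "inv_in j z \<notin> bead i"
      using ij bead_unique by blast
    then have "y \<in> open_bead i"
      using w ij inv_in_open_bead_iff[of i "inv_in j z"] by simp
    then show False
      using y(1) ij by (auto simp: fund_domain_def)
  qed
  then show ?thesis by blast
qed

text \<open>The extra \<open>Suc\<close> is for \<open>z\<close> on the boundary sphere of a bead
  \<open>j\<close> other than that of \<open>last w\<close>: then \<open>wmap w z\<close> also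
  equals \<open>wmap (w @ [j]) z\<close>, which lies in \<open>stage (length w)\<close>.\<close>

lemma wmap_domain_notin_stage:
  assumes "w \<noteq> []" "set w \<subseteq> ind" "distinct_adj w" "z \<in> fund_domain"
  shows "(fold_step ^^ Suc (length w)) (wmap w z) = z" "wmap w z \<notin> stage (Suc (length w))"
proof -
  have "last w \<in> ind"
    using assms(1,2) last_in_set by blast
  then have z: "norm z = 1" "z \<notin> open_bead (last w)"
    using assms(4) by (auto simp: fund_domain_def)
  have f: "(fold_step ^^ length w) (wmap w z) = z"
    using fold_pow_wmap[OF assms(1-3) z] by blast
  with assms(4) show "(fold_step ^^ Suc (length w)) (wmap w z) = z"
    by simp
  show "wmap w z \<notin> stage (Suc (length w))"
  proof
    assume s: "wmap w z \<in> stage (Suc (length w))"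
    have "(fold_step ^^ i) y \<in> stage (Suc m)" if "y \<in> stage (i + Suc m)" for i m y
      using that
    proof (induction i arbitrary: y)
      case (Suc i)
      then have "fold_step y \<in> stage (i + Suc m)"
        using fold_step_stage by simp
      from Suc.IH[OF this] show ?case
        by (simp add: funpow_swap1)
    qed simp
    from this[of "wmap w z" "length w" 0] s f assms(4) domain_Int_stage_1 show False
      by auto
  qed
qed

end

section \<open>The threads and the retraction of the complement of the limit space\<close>

locale beaded_subset = disjoint_round_balls +
  fixes K :: "'a set"
  assumes K_subset: "K \<subseteq> unit_sphere"
begin

abbreviation limit_space :: "'a set" where
  "limit_space \<equiv> inverse_limit_space k K c r"

text \<open>The recursion has two clauses. Points kept from the previous thread already have their
  \<open>m\<close>-th iterate in the domain, where another folding changes nothing. Points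
  \<open>wmap w z\<close> of the new pieces have \<open>z\<close> as iterate of order
  \<open>Suc m\<close>.\<close>

lemma thread_eq: "thread k K c r m = {y. norm y = 1 \<and> (fold_step ^^ m) y \<in> K}"
proof (induction m)
  case 0
  then show ?case using K_subset by auto
next
  case (Suc m)
  show ?case
  proof (intro equalityI subsetI)
    fix y assume "y \<in> thread k K c r (Suc m)"
    then consider "y \<in> thread k K c r m" "y \<notin> sphere_interior (stage m)"
      | w z where "w \<in> words (Suc m)" "z \<in> K" "z \<notin> sphere_interior (bead (last w))" "y = wmap w z"
      by auto
    then show "y \<in> {y. norm y = 1 \<and> (fold_step ^^ Suc m) y \<in> K}"
    proof cases
      case 1
      then have y: "norm y = 1" "(fold_step ^^ m) y \<in> K"
        using Suc.IH by auto
      \<comment> \<open>The points whose \<open>m\<close>-th iterate lies in a given open bead form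
        an open subset of \<open>stage m\<close>, hence lie in its interior, which has been
        removed.\<close>
      have "(fold_step ^^ m) y \<in> fund_domain"
      proof (rule ccontr)
        assume "(fold_step ^^ m) y \<notin> fund_domain"
        then obtain j where j: "j \<in> ind" "(fold_step ^^ m) y \<in> open_bead j"
          using domain_or_open_bead y(1) norm_fold_pow by blast
        have "openin (top_of_set unit_sphere) (unit_sphere \<inter> (fold_step ^^ m) -` ball (c j) (r j))"
          by (rule continuous_openin_preimage_gen[OF continuous_on_fold_pow open_ball])
        moreover have "unit_sphere \<inter> (fold_step ^^ m) -` ball (c j) (r j) \<subseteq> stage m"
          using open_bead_imp_stage[OF _ j(1)] by (auto simp: open_bead_def)
        ultimately have "unit_sphere \<inter> (fold_step ^^ m) -` ball (c j) (r j) \<subseteq> sphere_interior (stage m)"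
          by (rule interior_of_maximal[rotated])
        with 1 j y show False
          by (auto simp: open_bead_def)
      qed
      with y show ?thesis by simp
    next
      case (2 w z)
      have w: "w \<noteq> []" "last w \<in> ind"
        using words_Suc[OF 2(1)] by auto
      have z: "norm z = 1" "z \<notin> open_bead (last w)"
        using 2 K_subset sphere_interior_bead[OF w(2)] by auto
      show ?thesis
        using fold_pow_wmap[OF w(1) _ _ z] norm_wmap[OF _ z(1), of w] 2 by (auto simp: words_iff)
    qed
  next
    fix y assume "y \<in> {y. norm y = 1 \<and> (fold_step ^^ Suc m) y \<in> K}"
    then have y: "norm y = 1" "(fold_step ^^ Suc m) y \<in> K" by auto
    show "y \<in> thread k K c r (Suc m)"
    proof (cases "y \<in> stage m")
      case False
      then have "y \<in> thread k K c r m"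
        using y Suc.IH fold_pow_in_domain[OF y(1) False] by simp
      with False show ?thesis
        using interior_of_subset[of "top_of_set unit_sphere" "stage m"] by auto
    next
      case True
      then obtain w z where w: "w \<in> words (Suc m)" "norm z = 1" "z \<notin> open_bead (last w)" "y = wmap w z"
        by (rule stageE)
      have w': "w \<noteq> []" "last w \<in> ind"
        using words_Suc[OF w(1)] by auto
      have "(fold_step ^^ Suc m) y = z"
        using fold_pow_wmap[OF w'(1) _ _ w(2,3)] w by (auto simp: words_iff)
      then have "z \<in> K"
        using y by simp
      then show ?thesis
        using w sphere_interior_bead[OF w'(2)] by auto
    qed
  qed
qed

lemma notin_limit_space_iff:
  assumes "norm y = 1"
  shows "y \<notin> limit_space \<longleftrightarrow> (\<exists>m. y \<notin> stage m \<and> (fold_step ^^ m) y \<notin> K)"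
  using assms unfolding inverse_limit_space_def thread_eq by auto

text \<open>The eventual value of the iterates, which are constant once \<open>y\<close> has left a
  stage; \<open>LEAST\<close> merely fixes one admissible exponent. On points of all stages the
  value is arbitrary, but these belong to the limit space.\<close>

definition fold_to_domain :: "'a \<Rightarrow> 'a" where
  "fold_to_domain y = (fold_step ^^ (LEAST m. y \<notin> stage m)) y"

lemma fold_to_domain_eq:
  assumes "norm y = 1" "y \<notin> stage m"
  shows "fold_to_domain y = (fold_step ^^ m) y"
  unfolding fold_to_domain_def
  using fold_pow_stable[OF assms(1), of "LEAST m. y \<notin> stage m" m] assms(2)
    LeastI[of "\<lambda>m. y \<notin> stage m" m] Least_le[of "\<lambda>m. y \<notin> stage m" m] by simp

lemma fold_to_domain_in: "fold_to_domain \<in> unit_sphere - limit_space \<rightarrow> fund_domain - K"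
proof
  fix y assume "y \<in> unit_sphere - limit_space"
  then have y: "norm y = 1" "y \<notin> limit_space" by auto
  then obtain m where m: "y \<notin> stage m" "(fold_step ^^ m) y \<notin> K"
    using notin_limit_space_iff by blast
  then show "fold_to_domain y \<in> fund_domain - K"
    using fold_to_domain_eq[OF y(1) m(1)] fold_pow_in_domain[OF y(1) m(1)] by simp
qed

text \<open>The complements of the stages form an open cover, and on each of them the map is one
  fixed iterate.\<close>

lemma continuous_on_fold_to_domain: "continuous_on (unit_sphere - limit_space) fold_to_domain"
proof -
  let ?Z = "unit_sphere - limit_space"
  have "continuous_map (top_of_set ?Z) euclidean fold_to_domain"
  proof (rule pasting_lemma[where I = UNIV and T = "\<lambda>m. ?Z \<inter> - stage m" and f = "\<lambda>_. fold_to_domain"])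
    fix m
    show "openin (top_of_set ?Z) (?Z \<inter> - stage m)"
      unfolding openin_open using compact_stage[of m]
      by (intro exI[of _ "- stage m"]) (simp add: compact_imp_closed open_Compl)
    have "continuous_on (?Z \<inter> - stage m) fold_to_domain"
      by (rule continuous_on_eq[OF continuous_on_subset[OF continuous_on_fold_pow]]) (auto simp: fold_to_domain_eq)
    then show "continuous_map (subtopology (top_of_set ?Z) (?Z \<inter> - stage m)) euclidean fold_to_domain"
      by (simp add: subtopology_subtopology)
  next
    fix y assume "y \<in> topspace (top_of_set ?Z)"
    then show "\<exists>m. m \<in> UNIV \<and> y \<in> ?Z \<inter> - stage m \<and> fold_to_domain y = fold_to_domain y"
      using notin_limit_space_iff[of y] by auto
  qed auto
  then show ?thesis by simp
qed

lemma wmap_section: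
  assumes "w \<noteq> []" "set w \<subseteq> ind" "distinct_adj w" "z \<in> fund_domain - K"
  shows "wmap w z \<in> unit_sphere - limit_space" "fold_to_domain (wmap w z) = z"
proof -
  have n: "norm (wmap w z) = 1"
    using assms by (intro norm_wmap) (auto simp: fund_domain_def)
  have *: "(fold_step ^^ Suc (length w)) (wmap w z) = z" "wmap w z \<notin> stage (Suc (length w))"
    using wmap_domain_notin_stage assms by auto
  with assms(4) n show "wmap w z \<in> unit_sphere - limit_space"
    using notin_limit_space_iff[OF n] by auto
  show "fold_to_domain (wmap w z) = z"
    using fold_to_domain_eq[OF n *(2)] *(1) by simp
qed

end

section \<open>Limit points and small words\<close>

context disjoint_round_balls
begin

text \<open>An equivalence on the sphere that contains the orbit relation of the group: a generator
  moves a point by one step along or against folding. It replaces any normal form for group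
  elements.\<close>

definition fold_related :: "'a \<Rightarrow> 'a \<Rightarrow> bool" where
  "fold_related x y \<longleftrightarrow> (\<exists>l m. (fold_step ^^ l) x = (fold_step ^^ m) y)"

lemma fold_related_trans:
  assumes "fold_related x y" "fold_related y z"
  shows "fold_related x z"
proof -
  obtain l m p q where *: "(fold_step ^^ l) x = (fold_step ^^ m) y" "(fold_step ^^ p) y = (fold_step ^^ q) z"
    using assms unfolding fold_related_def by blast
  have "(fold_step ^^ (p + l)) x = (fold_step ^^ p) ((fold_step ^^ m) y)"
    using * by (simp add: funpow_add)
  also have "\<dots> = (fold_step ^^ m) ((fold_step ^^ p) y)"
    by (metis add.commute comp_apply funpow_add)
  also have "\<dots> = (fold_step ^^ (m + q)) z"
    using * by (simp add: funpow_add)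
  finally show ?thesis
    unfolding fold_related_def by blast
qed

lemma fold_related_sym: "fold_related x y \<Longrightarrow> fold_related y x"
  unfolding fold_related_def by metis

lemma fold_related_inv_in: "j \<in> ind \<Longrightarrow> norm x = 1 \<Longrightarrow> fold_related (inv_in j x) x"
proof -
  assume j: "j \<in> ind" and x: "norm x = 1"
  show ?thesis
  proof (cases "x \<in> bead j")
    case True
    then have "(fold_step ^^ 1) x = (fold_step ^^ 0) (inv_in j x)"
      using fold_step_bead[OF j] by simp
    then show ?thesis
      unfolding fold_related_def by metis
  next
    case False
    then have "inv_in j x \<in> bead j"
      using inv_in_bead_iff[OF j x] open_bead_subset by blast
    then have "(fold_step ^^ 1) (inv_in j x) = (fold_step ^^ 0) x"
      using fold_step_bead[OF j] j x by simp
    then show ?thesis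
      unfolding fold_related_def by metis
  qed
qed

lemma inversion_group_orbit:
  assumes "\<gamma> \<in> inversion_group k c r" "norm x = 1"
  shows "norm (\<gamma> x) = 1 \<and> fold_related (\<gamma> x) x"
proof -
  let ?B = "BijGroup (unit_sphere :: 'a set)"
  have gen: "restrict (inv_in j) unit_sphere \<in> Bij unit_sphere" if "j \<in> ind" for j
    using norm_center[OF that] radius[OF that] by (intro inversion_in_Bij) auto
  have "\<gamma> \<in> generate ?B ((\<lambda>j. restrict (inv_in j) unit_sphere) ` ind)"
    using assms(1) by (simp add: inversion_group_def ind_def)
  then have "\<gamma> \<in> Bij unit_sphere \<and> (\<forall>x. norm x = 1 \<longrightarrow> norm (\<gamma> x) = 1 \<and> fold_related (\<gamma> x) x)"
  proof (induction rule: generate.induct)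
    case one
    have "fold_related x x" for x
      unfolding fold_related_def by blast
    moreover have one: "\<one>\<^bsub>?B\<^esub> = (\<lambda>x\<in>unit_sphere. x)"
      by (simp add: BijGroup_def)
    ultimately show ?case
      unfolding one by (intro conjI id_Bij) auto
  next
    case (incl h)
    then show ?case
      using gen fold_related_inv_in by auto
  next
    \<comment> \<open>Generators are involutions, so the inverse of a generator is the generator
      itself.\<close>
    case (inv h)
    then obtain j where j: "j \<in> ind" "h = restrict (inv_in j) unit_sphere" by auto
    have "inv\<^bsub>?B\<^esub> h = h"
    proof (rule group.inv_equality[OF group_BijGroup])
      show "h \<otimes>\<^bsub>?B\<^esub> h = \<one>\<^bsub>?B\<^esub>"
        using gen[OF j(1)] j by (auto simp: BijGroup_def compose_def restrict_def)
    qed (use gen j in \<open>auto simp: BijGroup_def\<close>)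
    moreover have "h \<in> Bij unit_sphere"
      using gen j by simp
    moreover have "\<forall>x. norm x = 1 \<longrightarrow> norm (h x) = 1 \<and> fold_related (h x) x"
      using j fold_related_inv_in by simp
    ultimately show ?case by simp
  next
    case (eng g h)
    then have gh: "g \<otimes>\<^bsub>?B\<^esub> h = compose unit_sphere g h"
      by (simp add: BijGroup_def)
    have "compose unit_sphere g h \<in> Bij unit_sphere"
      using eng.IH by (blast intro: compose_Bij)
    moreover have "fold_related (g (h x)) x \<and> norm (g (h x)) = 1" if "norm x = 1" for x
      using eng.IH that fold_related_trans by blast
    ultimately show ?case
      unfolding gh by (simp add: compose_eq)
  qed
  with assms(2) show ?thesis by blast
qed

lemma finite_fold_pow_vimage: "finite {y. norm y = 1 \<and> (fold_step ^^ m) y = d}"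
proof (induction m arbitrary: d)
  case (Suc m)
  have one: "finite {y. norm y = 1 \<and> fold_step y = d}" for d
  proof (rule finite_subset)
    show "{y. norm y = 1 \<and> fold_step y = d} \<subseteq> insert d ((\<lambda>j. inv_in j d) ` ind)"
    proof
      fix y assume "y \<in> {y. norm y = 1 \<and> fold_step y = d}"
      then have y: "norm y = 1" "fold_step y = d" by auto
      show "y \<in> insert d ((\<lambda>j. inv_in j d) ` ind)"
      proof (cases "\<exists>j\<in>ind. y \<in> bead j")
        case True
        then obtain j where j: "j \<in> ind" "y \<in> bead j" by blast
        then have "y = inv_in j d"
          using fold_step_bead[OF j] y by auto
        with j show ?thesis by blast
      next
        case False
        then show ?thesis
          using y(2) by (simp add: fold_step_def)
      qed
    qed
  qed auto
  have "{y. norm y = 1 \<and> (fold_step ^^ Suc m) y = d} \<subseteq>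
      (\<Union>z\<in>{z. norm z = 1 \<and> fold_step z = d}. {y. norm y = 1 \<and> (fold_step ^^ m) y = z})"
    by auto
  then show ?case
    by (rule finite_subset) (use Suc one in auto)
qed simp

text \<open>Outside the closed set \<open>stage m\<close>, folding has stabilised after
  \<open>m\<close> steps. Orbit points there are all related, so they share the same
  \<open>m\<close>-th iterate; its fibre is finite, whereas infinitely many orbit points accumulate
  at a limit point.\<close>

lemma limit_set_subset_stage:
  assumes "y \<in> limit_set k c r"
  shows "y \<in> stage m"
proof (rule ccontr)
  assume ym: "y \<notin> stage m"
  obtain x where x: "norm x = 1" and lim: "y islimpt (\<lambda>\<gamma>. \<gamma> x) ` inversion_group k c r"
    using assms by (auto simp: limit_set_def)
  let ?O = "- stage m \<inter> (\<lambda>\<gamma>. \<gamma> x) ` inversion_group k c r"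
  have "open (- stage m)"
    using compact_stage by (simp add: compact_imp_closed open_Compl)
  then have inf: "infinite ?O"
    using lim ym unfolding islimpt_eq_acc_point by simp
  then have "?O \<noteq> {}"
    by (rule infinite_imp_nonempty)
  then obtain u0 where u0: "u0 \<in> ?O"
    by (meson ex_in_conv)
  have "(fold_step ^^ m) u = (fold_step ^^ m) u0 \<and> norm u = 1" if u: "u \<in> ?O" for u
  proof -
    have n: "norm u = 1" "norm u0 = 1" and rel: "fold_related u x" "fold_related u0 x"
      using u u0 inversion_group_orbit[OF _ x] by auto
    obtain l l' where l: "(fold_step ^^ l) u = (fold_step ^^ l') u0"
      using fold_related_trans[OF rel(1) fold_related_sym[OF rel(2)]] unfolding fold_related_def by blast
    have "(fold_step ^^ m) u = (fold_step ^^ (m + l)) u"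
      using fold_pow_stable[OF n(1), of m "m + l"] u by simp
    also have "\<dots> = (fold_step ^^ (m + l')) u0"
      by (simp add: funpow_add l)
    also have "\<dots> = (fold_step ^^ m) u0"
      using fold_pow_stable[OF n(2), of m "m + l'"] u0 by simp
    finally show ?thesis
      using n by simp
  qed
  then have "?O \<subseteq> {y. norm y = 1 \<and> (fold_step ^^ m) y = (fold_step ^^ m) u0}"
    by auto
  with finite_fold_pow_vimage inf show False
    using finite_subset by blast
qed

section \<open>Contraction by long words\<close>

lemma exists_uncovered_point:
  assumes "2 \<le> DIM('a)" "2 \<le> k"
  obtains p where "norm p = 1" "\<And>j. j \<in> ind \<Longrightarrow> p \<notin> bead j"
proof -
  have "\<not> unit_sphere \<subseteq> (\<Union>j\<in>ind. bead j)"
  proof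
    assume sub: "unit_sphere \<subseteq> (\<Union>j\<in>ind. bead j)"
    \<comment> \<open>One bead and the union of the others are disjoint, closed and nonempty, so
      they cannot cover the connected sphere.\<close>
    define U where "U = (\<Union>j\<in>ind - {1}. bead j)"
    have i: "1 \<in> ind" "2 \<in> ind"
      using assms(2) by (auto simp: ind_def)
    have "closed (bead 1)" "closed U"
      using closed_bead by (auto simp: U_def)
    moreover have "unit_sphere \<subseteq> bead 1 \<union> U"
      using sub by (auto simp: U_def)
    moreover have "bead 1 \<inter> U \<inter> unit_sphere = {}"
      using bead_unique[OF i(1)] by (auto simp: U_def)
    moreover have "bead 1 \<inter> unit_sphere \<noteq> {}"
      using center_in_bead[OF i(1)] bead_subset by blast
    moreover have "2 \<in> ind - {1}"
      using i by auto
    then have "U \<inter> unit_sphere \<noteq> {}"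
      unfolding U_def using center_in_bead[OF i(2)] bead_subset by blast
    ultimately show False
      using connected_sphere[OF assms(1), of 0 1] unfolding connected_closed by blast
  qed
  then obtain p where "p \<in> unit_sphere" "p \<notin> (\<Union>j\<in>ind. bead j)"
    by blast
  then show thesis
    by (intro that[of p]) auto
qed

text \<open>Chordal distances need not be contracted by the inversion in a bead larger than a hemisphere.
  The distance \<open>|x - y| / (|x - p| |y - p|)\<close> after stereographic projection from a point \<open>p\<close>
  outside all beads is.\<close>

definition proj_dist :: "'a \<Rightarrow> 'a \<Rightarrow> 'a \<Rightarrow> real" where
  "proj_dist p x y = (dist x y)\<^sup>2 / ((dist x p)\<^sup>2 * (dist y p)\<^sup>2)"

text \<open>The point \<open>p\<close> and bead \<open>i\<close> lie strictly on the same side of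
  the hyperplane of bead \<open>j\<close>. Hence the mixed term in
  \<open>dist_inversion_point\<close> is positive, uniformly on the compact bead, and finitely many
  pairs of beads yield one factor.\<close>

lemma exists_contraction_factor:
  assumes "norm p = 1" "\<And>j. j \<in> ind \<Longrightarrow> p \<notin> bead j"
  obtains q where "0 < q" "q < 1"
    "\<And>i j x y. i \<in> ind \<Longrightarrow> j \<in> ind \<Longrightarrow> i \<noteq> j \<Longrightarrow> x \<in> bead i \<Longrightarrow> y \<in> bead i \<Longrightarrow>
      proj_dist p (inv_in j x) (inv_in j y) \<le> q\<^sup>2 * proj_dist p x y"
proof -
  define t where "t j = 1 - (r j)\<^sup>2 / 2" for j
  have "\<exists>d>0. \<forall>x\<in>bead i. t j - x \<bullet> c j \<ge> d" if ij: "i \<in> ind" "j \<in> ind" "i \<noteq> j" for i j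
  proof -
    have ne: "bead i \<noteq> {}"
      using center_in_bead[OF ij(1)] by auto
    have "compact (bead i)"
      by (simp add: round_ball_def compact_Int_closed)
    moreover have "continuous_on (bead i) (\<lambda>x. t j - x \<bullet> c j)"
      by (intro continuous_intros)
    ultimately obtain x0 where x0: "x0 \<in> bead i" "\<And>x. x \<in> bead i \<Longrightarrow> t j - x0 \<bullet> c j \<le> t j - x \<bullet> c j"
      using continuous_attains_inf[OF _ ne, of "\<lambda>x. t j - x \<bullet> c j"] by blast
    have "x0 \<notin> bead j"
      using bead_unique ij x0(1) by blast
    then have "t j - x0 \<bullet> c j > 0"
      using dist_less_iff_height(2)[OF norm_center[OF ij(2)], of x0 "r j"] x0(1) radius[OF ij(2)]
      by (auto simp: round_ball_iff t_def)
    with x0 show ?thesis by blast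
  qed
  then obtain d where d: "\<And>i j. i \<in> ind \<Longrightarrow> j \<in> ind \<Longrightarrow> i \<noteq> j \<Longrightarrow> d i j > 0"
    "\<And>i j x. i \<in> ind \<Longrightarrow> j \<in> ind \<Longrightarrow> i \<noteq> j \<Longrightarrow> x \<in> bead i \<Longrightarrow> t j - x \<bullet> c j \<ge> d i j"
    by metis
  have e: "t j - p \<bullet> c j > 0" if "j \<in> ind" for j
    using dist_less_iff_height(2)[OF norm_center[OF that], of p "r j"] assms that radius[OF that]
    by (auto simp: round_ball_iff t_def)
  \<comment> \<open>The inserted 1 keeps the minimum defined and positive when there is no pair of
    different beads.\<close>
  define \<delta> where "\<delta> = Min (insert 1 ((\<lambda>(i,j). d i j * (t j - p \<bullet> c j)) ` {(i,j). i \<in> ind \<and> j \<in> ind \<and> i \<noteq> j}))"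
  have fin: "finite ((\<lambda>(i,j). d i j * (t j - p \<bullet> c j)) ` {(i,j). i \<in> ind \<and> j \<in> ind \<and> i \<noteq> j})"
    by (rule finite_imageI, rule finite_subset[of _ "ind \<times> ind"]) auto
  have \<delta>: "\<delta> > 0"
    unfolding \<delta>_def using fin d(1) e by (subst Min_gr_iff) auto
  have \<delta>_le: "\<delta> \<le> (p \<bullet> c j - t j) * (x \<bullet> c j - t j)" if ij: "i \<in> ind" "j \<in> ind" "i \<noteq> j" "x \<in> bead i" for i j x
  proof -
    have "\<delta> \<le> d i j * (t j - p \<bullet> c j)"
      unfolding \<delta>_def using fin ij by (intro Min_le) auto
    also have "\<dots> \<le> (t j - x \<bullet> c j) * (t j - p \<bullet> c j)"
      using d(2)[OF ij] e[OF ij(2)] by (intro mult_right_mono) auto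
    finally show ?thesis
      by (simp add: algebra_simps)
  qed
  \<comment> \<open>With \<open>T \<le> 1\<close> and chordal distances at most 2,
    \<open>T * (dist z p)\<^sup>2\<close> is at most 4, while the mixed term is at least
    \<open>4 * \<delta>\<close>. So \<open>M z\<close> is at least \<open>1 + \<delta>\<close> times
    \<open>T * (dist z p)\<^sup>2\<close>.\<close>
  define q where "q = 1 / (1 + \<delta>)"
  show thesis
  proof (rule that[of q])
    show "0 < q"
      using \<delta> by (simp add: q_def)
    show "q < 1"
      using \<delta> by (simp add: q_def)
    fix i j x y assume ij: "i \<in> ind" "j \<in> ind" "i \<noteq> j" and xy: "x \<in> bead i" "y \<in> bead i"
    define N where "N = inversion_denom (c j) (r j)"
    define T where "T = 1 - (t j)\<^sup>2"
    \<comment> \<open>On unit vectors, \<open>M\<close> is the squared distance of the image from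
      \<open>p\<close>, multiplied by the denominator \<open>N\<close>. The denominators cancel in
      \<open>proj_dist\<close> of two images.\<close>
    define M where "M x = T * (dist x p)\<^sup>2 + 4 * (p \<bullet> c j - t j) * (x \<bullet> c j - t j)" for x
    have nc: "norm (c j) = 1" "0 < r j" "r j < 2"
      using norm_center radius ij by auto
    have n: "norm x = 1" "norm y = 1"
      using xy by (auto simp: round_ball_iff)
    have "\<bar>t j\<bar> < 1"
      using abs_height_less_1[OF nc(1) nc(1) nc(2,3)] by (simp add: t_def)
    then have T: "0 < T" "T \<le> 1"
      using abs_square_less_1[of "t j"] by (auto simp: T_def)
    have M: "N z * (dist (inv_in j z) p)\<^sup>2 = M z" "N z > 0" if "norm z = 1" for z
      using dist_inversion_point[OF nc(1) that assms(1) nc(2,3)] inversion_denom_pos[OF nc(1) that nc(2,3)]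
      by (simp_all add: N_def M_def T_def t_def)
    have D: "N x * N y * (dist (inv_in j x) (inv_in j y))\<^sup>2 = T\<^sup>2 * (dist x y)\<^sup>2"
      using dist_inversion_inversion[OF nc(1) n nc(2,3)] by (simp add: N_def T_def t_def)
    have pne: "z \<noteq> p" if "z \<in> bead i" for z
      using assms(2) ij that by blast
    have Mq: "T * (dist z p)\<^sup>2 \<le> q * M z" "M z > 0" "(dist z p)\<^sup>2 > 0" if z: "z \<in> bead i" for z
    proof -
      have "dist z p \<le> 2"
        using norm_triangle_ineq4[of z p] z assms(1) by (auto simp: round_ball_iff dist_norm)
      then have "(dist z p)\<^sup>2 \<le> 2\<^sup>2"
        by (intro power_mono) auto
      then have "T * (dist z p)\<^sup>2 \<le> 1 * 4"
        using T by (intro mult_mono) auto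
      then have "\<delta> * (T * (dist z p)\<^sup>2) \<le> \<delta> * 4"
        using \<delta> by simp
      also have "\<dots> \<le> 4 * ((p \<bullet> c j - t j) * (z \<bullet> c j - t j))"
        using \<delta>_le[OF ij z] by linarith
      also have "\<dots> = 4 * (p \<bullet> c j - t j) * (z \<bullet> c j - t j)"
        by (simp only: mult.assoc)
      finally have "(1 + \<delta>) * (T * (dist z p)\<^sup>2) \<le> M z"
        by (simp add: M_def algebra_simps)
      then show "T * (dist z p)\<^sup>2 \<le> q * M z"
        using \<delta> by (simp add: q_def field_simps)
      show "(dist z p)\<^sup>2 > 0"
        using pne[OF z] by simp
      with T \<open>(1 + \<delta>) * (T * (dist z p)\<^sup>2) \<le> M z\<close> \<delta> show "M z > 0"
        by (smt (verit, best) mult_pos_pos)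
    qed
    define dx dy where "dx = (dist x p)\<^sup>2" and "dy = (dist y p)\<^sup>2"
    have "proj_dist p (inv_in j x) (inv_in j y) =
        (T\<^sup>2 * (dist x y)\<^sup>2) / (M x * M y)"
    proof -
      have "(T\<^sup>2 * (dist x y)\<^sup>2) / (M x * M y) =
          (N x * N y * (dist (inv_in j x) (inv_in j y))\<^sup>2) /
          ((N x * N y) * ((dist (inv_in j x) p)\<^sup>2 * (dist (inv_in j y) p)\<^sup>2))"
      proof -
        have "(N x * N y) * ((dist (inv_in j x) p)\<^sup>2 * (dist (inv_in j y) p)\<^sup>2) =
            (N x * (dist (inv_in j x) p)\<^sup>2) * (N y * (dist (inv_in j y) p)\<^sup>2)"
          by (simp only: mult_ac)
        then show ?thesis
          unfolding M(1)[OF n(1)] M(1)[OF n(2)] D by simp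
      qed
      also have "\<dots> = proj_dist p (inv_in j x) (inv_in j y)"
        using M(2)[OF n(1)] M(2)[OF n(2)] unfolding proj_dist_def by simp
      finally show ?thesis ..
    qed
    also have "\<dots> \<le> q\<^sup>2 * ((dist x y)\<^sup>2 / (dx * dy))"
    proof -
      have "(T * dx) * (T * dy) \<le> (q * M x) * (q * M y)"
        using Mq[OF xy(1)] Mq[OF xy(2)] T \<open>0 < q\<close> unfolding dx_def dy_def
        by (intro mult_mono[of "T * _" "q * _"]) (auto intro: less_imp_le)
      then have "T\<^sup>2 * (dx * dy) * (dist x y)\<^sup>2 \<le> q\<^sup>2 * (M x * M y) * (dist x y)\<^sup>2"
        by (intro mult_right_mono) (auto simp: power2_eq_square algebra_simps)
      moreover have "0 < M x * M y" "0 < dx * dy"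
        using Mq[OF xy(1)] Mq[OF xy(2)] by (auto simp: dx_def dy_def)
      ultimately show ?thesis
        by (simp add: pos_divide_le_eq pos_le_divide_eq algebra_simps)
    qed
    finally show "proj_dist p (inv_in j x) (inv_in j y) \<le> q\<^sup>2 * proj_dist p x y"
      by (simp add: proj_dist_def dx_def dy_def)
  qed
qed

text \<open>The limit point is \<open>wmap w z\<close> for words \<open>w\<close> of every length.
  The last letter brings \<open>z\<close> and the whole fundamental domain into one bead, and each
  of the \<open>m\<close> remaining letters contracts, so \<open>wmap w\<close> carries the domain
  close to \<open>wmap w z\<close>.\<close>

lemma limit_set_small_word:
  assumes "2 \<le> DIM('a)" "2 \<le> k" and x: "x \<in> limit_set k c r"
    and U: "openin (top_of_set unit_sphere) U" "x \<in> U"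
  obtains w where "w \<noteq> []" "set w \<subseteq> ind" "distinct_adj w" "wmap w ` fund_domain \<subseteq> U"
proof -
  obtain p where p: "norm p = 1" "\<And>j. j \<in> ind \<Longrightarrow> p \<notin> bead j"
    using exists_uncovered_point[OF assms(1,2)] by blast
  obtain q where q: "0 < q" "q < 1"
    "\<And>i j x y. i \<in> ind \<Longrightarrow> j \<in> ind \<Longrightarrow> i \<noteq> j \<Longrightarrow> x \<in> bead i \<Longrightarrow> y \<in> bead i \<Longrightarrow>
      proj_dist p (inv_in j x) (inv_in j y) \<le> q\<^sup>2 * proj_dist p x y"
    using exists_contraction_factor[OF p] by blast
  \<comment> \<open>Appending \<open>j\<close> gives \<open>hd\<close> a meaning for empty
    \<open>v\<close> and records the bead in which the two points start.\<close>
  have contr: "wmap v x \<in> bead (hd (v @ [j])) \<and> wmap v y \<in> bead (hd (v @ [j])) \<and>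
      proj_dist p (wmap v x) (wmap v y) \<le> (q\<^sup>2) ^ length v * proj_dist p x y"
    if "set (v @ [j]) \<subseteq> ind" "distinct_adj (v @ [j])" "x \<in> bead j" "y \<in> bead j" for v j x y
    using that
  proof (induction v)
    case (Cons i v)
    let ?h = "hd (v @ [j])"
    have IH: "wmap v x \<in> bead ?h" "wmap v y \<in> bead ?h"
      "proj_dist p (wmap v x) (wmap v y) \<le> (q\<^sup>2) ^ length v * proj_dist p x y"
      using Cons by auto (auto simp: distinct_adj_Cons)
    have ih: "i \<in> ind" "?h \<in> ind" "i \<noteq> ?h"
      using Cons.prems by (cases v; auto)+
    have b: "inv_in i (wmap v z) \<in> bead i" if "wmap v z \<in> bead ?h" for z
    proof -
      have "wmap v z \<notin> open_bead i"
        using that bead_unique[OF ih(1,2)] ih(3) open_bead_subset by blast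
      then show ?thesis
        using inv_in_bead_iff[OF ih(1), of "wmap v z"] that by (simp add: round_ball_iff)
    qed
    have "proj_dist p (inv_in i (wmap v x)) (inv_in i (wmap v y)) \<le> q\<^sup>2 * proj_dist p (wmap v x) (wmap v y)"
      using q(3)[OF ih(2,1) _ IH(1,2)] ih(3) by auto
    also have "\<dots> \<le> q\<^sup>2 * ((q\<^sup>2) ^ length v * proj_dist p x y)"
      using IH(3) by (intro mult_left_mono) auto
    finally show ?case
      using b IH by (simp add: mult.assoc)
  qed auto
  have clB: "closed (\<Union>j\<in>ind. bead j)"
    using closed_bead by auto
  then obtain h where h: "h > 0" "\<And>z j. j \<in> ind \<Longrightarrow> z \<in> bead j \<Longrightarrow> h \<le> dist z p"
    using separate_point_closed[of "\<Union>j\<in>ind. bead j" p] p(2) by (auto simp: dist_commute)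
  have le2: "dist y z \<le> 2" if "norm y = 1" "norm z = 1" for y z :: 'a
    using norm_triangle_ineq4[of y z] that by (simp add: dist_norm)
  \<comment> \<open>The numerator of \<open>proj_dist\<close> is at most \<open>2\<^sup>2\<close>,
    and beads keep the distance \<open>h\<close> from \<open>p\<close>.\<close>
  define C where "C = 4 / (h\<^sup>2 * h\<^sup>2)"
  have C: "proj_dist p y z \<le> C" if "j \<in> ind" "y \<in> bead j" "z \<in> bead j" for j y z
  proof -
    have "(dist y z)\<^sup>2 \<le> 2\<^sup>2"
      using that by (intro power_mono le2) (auto simp: round_ball_iff)
    moreover have "h\<^sup>2 \<le> (dist y p)\<^sup>2" "h\<^sup>2 \<le> (dist z p)\<^sup>2"
      using h that by (auto intro!: power_mono)
    ultimately show ?thesis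
      unfolding proj_dist_def C_def using h(1)
      by (intro frac_le mult_mono) auto
  qed
  obtain e where e: "e > 0" "unit_sphere \<inter> ball x e \<subseteq> U"
    using U by (auto simp: openin_contains_ball Int_commute)
  \<comment> \<open>The factor 16 returns to chordal distance: both squared distances from
    \<open>p\<close> are at most \<open>2\<^sup>2\<close>.\<close>
  have "(\<lambda>m. 16 * C * (q\<^sup>2) ^ m) \<longlonglongrightarrow> 16 * C * 0"
    using q by (intro tendsto_intros LIMSEQ_power_zero) (simp add: abs_square_less_1)
  then have "\<forall>\<^sub>F m in sequentially. 16 * C * (q\<^sup>2) ^ m < e\<^sup>2"
    using e(1) by (intro order_tendstoD(2)[of _ 0]) auto
  then obtain m where m: "16 * C * (q\<^sup>2) ^ m < e\<^sup>2"
    by (auto simp: eventually_sequentially)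
  obtain w z where w: "w \<in> words (Suc m)" "norm z = 1" "z \<notin> open_bead (last w)" "x = wmap w z"
    using limit_set_subset_stage[OF x] by (rule stageE)
  have w': "w \<noteq> []" "last w \<in> ind"
    using words_Suc[OF w(1)] by auto
  have bl: "butlast w @ [last w] = w"
    using w'(1) by simp
  have wm: "wmap w y = wmap (butlast w) (inv_in (last w) y)" for y
    using wmap_append[of "butlast w" "[last w]"] w' by simp
  have "wmap w y \<in> U" if y: "y \<in> fund_domain" for y
  proof -
    have ny: "norm y = 1" "y \<notin> open_bead (last w)"
      using y w'(2) by (auto simp: fund_domain_def)
    have "inv_in (last w) z \<in> bead (last w)" "inv_in (last w) y \<in> bead (last w)"
      using inv_in_bead_iff[OF w'(2)] ny w by auto
    note ct = contr[of "butlast w" "last w", unfolded bl, OF _ _ this] C[OF w'(2) this]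
    have pd: "proj_dist p x (wmap w y) \<le> (q\<^sup>2) ^ m * C" and n: "norm x = 1" "norm (wmap w y) = 1"
    proof -
      have "proj_dist p x (wmap w y) \<le> (q\<^sup>2) ^ m * proj_dist p (inv_in (last w) z) (inv_in (last w) y)"
        using ct(1) w by (auto simp: words_iff wm)
      also have "\<dots> \<le> (q\<^sup>2) ^ m * C"
        using ct(2) by (intro mult_left_mono) auto
      finally show "proj_dist p x (wmap w y) \<le> (q\<^sup>2) ^ m * C" .
      show "norm x = 1" "norm (wmap w y) = 1"
        using w ny norm_wmap[of w] by (auto simp: words_iff)
    qed
    have pos: "dist x p > 0" "dist (wmap w y) p > 0"
    proof -
      have "hd w \<in> ind"
        using w(1) w'(1) by (cases w) (auto simp: words_iff)
      moreover have "x \<in> bead (hd w)" "wmap w y \<in> bead (hd w)"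
        using ct(1) w by (auto simp: words_iff wm)
      ultimately show "dist x p > 0" "dist (wmap w y) p > 0"
        using h by (meson less_le_trans)+
    qed
    have "(dist x (wmap w y))\<^sup>2 = proj_dist p x (wmap w y) * ((dist x p)\<^sup>2 * (dist (wmap w y) p)\<^sup>2)"
      using pos by (simp add: proj_dist_def)
    also have "\<dots> \<le> ((q\<^sup>2) ^ m * C) * (2\<^sup>2 * 2\<^sup>2)"
      using n p(1) pd by (intro mult_mono power_mono le2) (auto simp: proj_dist_def C_def)
    also have "\<dots> < e\<^sup>2"
      using m by (simp add: mult.commute mult.left_commute)
    finally have "dist x (wmap w y) < e"
      using e(1) by (simp add: power_less_imp_less_base)
    with n e(2) show ?thesis by auto
  qed
  then show thesis
    using that[of w] w'(1) w(1) by (auto simp: words_iff)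
qed

end

section \<open>Pushing off trivial tangles\<close>

text \<open>A homeomorphism of closed balls preserves interiors by invariance of domain, applied in
  both directions. The round ball lies on a sphere, so it is first carried into a Euclidean space by
  puncturing at \<open>- c\<close>, which is at distance 2 from \<open>c\<close> and thus outside
  the ball.\<close>

lemma homeomorphism_round_ball_interior_iff:
  fixes h :: "'a::euclidean_space \<Rightarrow> 'b::euclidean_space"
  assumes dim: "DIM('a) = Suc (DIM('b))" and c: "norm c = 1" and r: "0 < r" "r < 2"
    and hg: "homeomorphism (round_ball c r) (cball 0 1) h g" and x: "x \<in> round_ball c r"
  shows "h x \<in> ball 0 1 \<longleftrightarrow> dist c x < r"
proof -
  define O' where "O' = {x. norm x = 1 \<and> dist c x < r}"
  have int: "sphere_interior (round_ball c r) = O'"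
    unfolding O'_def using sphere_interior_round_ball[OF c r] .
  have OB: "O' \<subseteq> round_ball c r"
    unfolding int[symmetric] by (rule interior_of_subset)
  have "dist c (- c) = 2"
    using c norm_scaleR[of 2 c] by (simp add: dist_norm scaleR_2)
  then have cB: "round_ball c r \<subseteq> unit_sphere - {- c}"
    using r by (auto simp: round_ball_iff)
  have "unit_sphere - {- c} homeomorphic (UNIV :: 'b set)"
    using c dim by (intro homeomorphic_punctured_sphere_affine) (auto simp: aff_dim_UNIV)
  then obtain \<sigma> \<tau> where \<sigma>: "homeomorphism (unit_sphere - {- c}) (UNIV :: 'b set) \<sigma> \<tau>"
    unfolding homeomorphic_def by blast
  have \<tau>\<sigma>: "\<tau> (\<sigma> y) = y" if "y \<in> unit_sphere - {- c}" for y
    using \<sigma> that by (auto simp: homeomorphism_def)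
  have h: "continuous_on (round_ball c r) h" "continuous_on (cball 0 1) g"
    "\<And>y. y \<in> round_ball c r \<Longrightarrow> g (h y) = y" "\<And>v. v \<in> cball 0 1 \<Longrightarrow> h (g v) = v"
    "h ` round_ball c r = cball 0 1" "g ` cball 0 1 = round_ball c r"
    using hg unfolding homeomorphism_def by blast+
  show ?thesis
  proof
    assume "dist c x < r"
    then have xO: "x \<in> O'"
      using x by (simp add: O'_def round_ball_iff)
    have "openin (top_of_set unit_sphere) O'"
      unfolding int[symmetric] by (rule openin_interior_of)
    then have "openin (top_of_set (unit_sphere - {- c})) O'"
      by (rule openin_subset_trans) (use OB cB in auto)
    then have "open (\<sigma> ` O')"
      using homeomorphism_imp_open_map[OF \<sigma>] by simp
    moreover have "continuous_on (\<sigma> ` O') (h \<circ> \<tau>)"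
    proof (rule continuous_on_compose)
      show "continuous_on (\<sigma> ` O') \<tau>"
        using \<sigma> by (auto simp: homeomorphism_def intro: continuous_on_subset)
      have "\<tau> ` \<sigma> ` O' \<subseteq> round_ball c r"
        using \<tau>\<sigma> OB cB by force
      then show "continuous_on (\<tau> ` \<sigma> ` O') h"
        by (rule continuous_on_subset[OF h(1)])
    qed
    moreover have "inj_on (h \<circ> \<tau>) (\<sigma> ` O')"
      by (rule inj_on_inverseI[of _ "\<sigma> \<circ> g"]) (use \<tau>\<sigma> h(3) OB cB in \<open>auto simp: subset_iff\<close>)
    ultimately have "open ((h \<circ> \<tau>) ` \<sigma> ` O')"
      by (intro invariance_of_domain)
    moreover have "(h \<circ> \<tau>) ` \<sigma> ` O' = h ` O'"
      using \<tau>\<sigma> OB cB by (force simp: image_comp)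
    ultimately have "h ` O' \<subseteq> interior (cball 0 1)"
      using h(5) OB by (intro interior_maximal) auto
    then show "h x \<in> ball 0 1"
      using xO by (auto simp: interior_cball)
  next
    assume hx: "h x \<in> ball 0 1"
    have gb: "g ` ball 0 1 \<subseteq> round_ball c r"
      using h(6) by auto
    have "open ((\<sigma> \<circ> g) ` ball 0 1)"
    proof (rule invariance_of_domain)
      show "continuous_on (ball 0 1) (\<sigma> \<circ> g)"
      proof (rule continuous_on_compose)
        show "continuous_on (ball 0 1) g"
          by (rule continuous_on_subset[OF h(2)]) auto
        show "continuous_on (g ` ball 0 1) \<sigma>"
          using \<sigma> gb cB by (auto simp: homeomorphism_def elim!: continuous_on_subset)
      qed
      show "inj_on (\<sigma> \<circ> g) (ball 0 1)"
        by (rule inj_on_inverseI[of _ "h \<circ> \<tau>"]) (use \<tau>\<sigma> h(4) gb cB in \<open>force simp: subset_iff image_subset_iff\<close>)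
    qed auto
    then have "openin (top_of_set (unit_sphere - {- c})) (\<tau> ` (\<sigma> \<circ> g) ` ball 0 1)"
      using homeomorphism_imp_open_map[OF homeomorphism_symD[OF \<sigma>]] by simp
    moreover have "\<tau> ` (\<sigma> \<circ> g) ` ball 0 1 = g ` ball 0 1"
      using \<tau>\<sigma> gb cB by (force simp: image_comp image_subset_iff subset_iff)
    moreover have "openin (top_of_set unit_sphere) (unit_sphere - {- c})"
      by (rule openin_delete) simp
    ultimately have "openin (top_of_set unit_sphere) (g ` ball 0 1)"
      using openin_trans by fastforce
    then have "g ` ball 0 1 \<subseteq> O'"
      unfolding int[symmetric] using gb by (intro interior_of_maximal)
    moreover have "x \<in> g ` ball 0 1"
      using h(3)[OF x] hx by (metis imageI)
    ultimately show "dist c x < r"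
      by (auto simp: O'_def)
  qed
qed

context beaded_subset
begin

text \<open>In the model disk, push radially to the boundary. Positive scaling respects
  \<open>flat\<close>, so the complement of \<open>K\<close> is preserved, and the centre, where the
  push is undefined, is in \<open>flat\<close>. Boundary points stay fixed, so the push extends by
  the identity.\<close>

lemma retraction_off_beads:
  assumes dim: "DIM('a) = Suc (DIM('b::euclidean_space \<times> real \<times> real))"
    and tangle: "\<And>j. j \<in> ind \<Longrightarrow> \<exists>h g. pair_homeomorphism (bead j) (bead j \<inter> K)
       (cball 0 1 :: ('b \<times> real \<times> real) set) (cball 0 1 \<inter> flat) h g"
  obtains \<rho> where "continuous_on (unit_sphere - K) \<rho>" "\<rho> \<in> unit_sphere - K \<rightarrow> fund_domain - K"
    "homotopic_with_canon (\<lambda>_. True) (unit_sphere - K) (unit_sphere - K) id \<rho>"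
proof -
  let ?E = "unit_sphere - K"
  obtain h :: "nat \<Rightarrow> 'a \<Rightarrow> 'b \<times> real \<times> real" and g where
    hg: "\<And>j. j \<in> ind \<Longrightarrow> pair_homeomorphism (bead j) (bead j \<inter> K) (cball 0 1) (cball 0 1 \<inter> flat) (h j) (g j)"
    using tangle by metis
  have h: "continuous_on (bead j) (h j)" "continuous_on (cball 0 1) (g j)"
    "\<And>y. y \<in> bead j \<Longrightarrow> g j (h j y) = y" "\<And>v. v \<in> cball 0 1 \<Longrightarrow> h j (g j v) = v"
    "\<And>y. y \<in> bead j \<Longrightarrow> h j y \<in> cball 0 1" "\<And>v. v \<in> cball 0 1 \<Longrightarrow> g j v \<in> bead j"
    "h j ` (bead j \<inter> K) = cball 0 1 \<inter> flat"
    if "j \<in> ind" for j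
    using hg[OF that] unfolding pair_homeomorphism_def homeomorphism_def by blast+
  have sph: "h j x \<in> ball 0 1 \<longleftrightarrow> x \<in> open_bead j" if "j \<in> ind" "x \<in> bead j" for j x
    using homeomorphism_round_ball_interior_iff[OF dim norm_center[OF that(1)], of "r j" "h j" "g j" x]
      hg[OF that(1)] radius[OF that(1)] that(2)
    by (auto simp: pair_homeomorphism_def open_bead_def round_ball_iff)
  have flat: "h j x \<in> flat \<longleftrightarrow> x \<in> K" if jx: "j \<in> ind" "x \<in> bead j" for j x
  proof
    assume "h j x \<in> flat"
    then obtain y where "y \<in> bead j \<inter> K" "h j x = h j y"
      using h(5,7)[OF jx(1)] jx(2) by (metis (no_types, lifting) IntI imageE)
    then show "x \<in> K"
      using h(3)[OF jx(1)] jx(2) by (metis IntE)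
  qed (use h(7)[OF jx(1)] jx(2) in blast)
  \<comment> \<open>The factor by which the norm of a nonzero \<open>v\<close> is moved linearly
    from its value to 1 as \<open>u\<close> runs from 0 to 1.\<close>
  define s where "s u v = (1 - u) + u / norm v" for u :: real and v :: "'b \<times> real \<times> real"
  have s: "norm (s u v *\<^sub>R v) = (1 - u) * norm v + u" "s u v > 0"
    if "v \<noteq> 0" "u \<in> {0..1}" for u v
  proof -
    have "s u v * norm v = (1 - u) * norm v + u" "norm v > 0"
      using that by (simp_all add: s_def distrib_right)
    moreover show "s u v > 0"
      using that by (cases "u = 0") (auto simp: s_def intro!: add_nonneg_pos)
    ultimately show "norm (s u v *\<^sub>R v) = (1 - u) * norm v + u"
      by simp
  qed
  have h0: "h j x \<noteq> 0" if "j \<in> ind" "x \<in> bead j" "x \<notin> K" for j x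
    using flat[OF that(1,2)] that(3) by (auto simp: flat_def)
  have scb: "s u (h j x) *\<^sub>R h j x \<in> cball 0 1" if "j \<in> ind" "x \<in> bead j" "x \<notin> K" "u \<in> {0..1}" for j u x
  proof -
    have "(1 - u) * norm (h j x) + u \<le> (1 - u) * 1 + u"
      using h(5)[OF that(1,2)] that(4) by (intro add_mono mult_left_mono) auto
    then show ?thesis
      using s(1)[OF h0[OF that(1,2,3)] that(4)] by simp
  qed
  define P where "P u j x = g j (s u (h j x) *\<^sub>R h j x)" for u j x
  have P: "P u j x \<in> bead j" "P u j x \<notin> K" "h j (P u j x) = s u (h j x) *\<^sub>R h j x"
    if "j \<in> ind" "x \<in> bead j" "x \<notin> K" "u \<in> {0..1}" for j u x
  proof -
    show b: "P u j x \<in> bead j" and hP: "h j (P u j x) = s u (h j x) *\<^sub>R h j x"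
      using h(4,6)[OF that(1) scb[OF that]] by (auto simp: P_def)
    have "h j x \<notin> flat"
      using flat that by auto
    then have "s u (h j x) *\<^sub>R h j x \<notin> flat"
      using s(2)[OF h0[OF that(1,2,3)] that(4)] by (simp add: flat_def)
    then show "P u j x \<notin> K"
      using flat[OF that(1) b] hP by simp
  qed
  have P_boundary: "P u j x = x" if "j \<in> ind" "x \<in> bead j" "x \<notin> open_bead j" for u j x
  proof -
    have "norm (h j x) = 1"
      using sph[OF that(1,2)] h(5)[OF that(1,2)] that(3) by auto
    then show ?thesis
      using h(3)[OF that(1,2)] by (simp add: P_def s_def)
  qed
  define H where "H = (\<lambda>(u, x). if \<exists>j\<in>ind. x \<in> bead j then P u (SOME j. j \<in> ind \<and> x \<in> bead j) x else x)"
  have H_bead: "H (u, x) = P u j x" if "j \<in> ind" "x \<in> bead j" for u j x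
  proof -
    have "(SOME i. i \<in> ind \<and> x \<in> bead i) = j"
      using that bead_unique by (intro some_equality) auto
    with that show ?thesis by (auto simp: H_def)
  qed
  have H_domain: "H (u, x) = x" if "x \<in> fund_domain" for u x
  proof (cases "\<exists>j\<in>ind. x \<in> bead j")
    case True
    then obtain j where "j \<in> ind" "x \<in> bead j" by blast
    with that show ?thesis
      using P_boundary H_bead by (auto simp: fund_domain_def)
  qed (auto simp: H_def)
  have cases: "x \<in> fund_domain \<or> (\<exists>j\<in>ind. x \<in> bead j)" if "x \<in> ?E" for x
    using domain_or_open_bead[of x] that open_bead_subset by auto
  have H_E: "H (u, x) \<in> ?E" if xu: "x \<in> ?E" "u \<in> {0..1}" for u x
  proof (cases "x \<in> fund_domain")
    case True
    then show ?thesis using H_domain xu by simp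
  next
    case False
    then obtain j where j: "j \<in> ind" "x \<in> bead j"
      using cases xu by blast
    then show ?thesis
      unfolding H_bead[OF j] using P(1,2)[OF j _ xu(2)] bead_subset xu(1) by blast
  qed
  have H0: "H (0, x) = x" if xE: "x \<in> ?E" for x
  proof (cases "x \<in> fund_domain")
    case False
    then obtain j where j: "j \<in> ind" "x \<in> bead j"
      using cases xE by blast
    then show ?thesis
      using h(3)[OF j] by (simp add: H_bead P_def s_def)
  qed (rule H_domain)
  have H1: "H (1, x) \<in> fund_domain - K" if xE: "x \<in> ?E" for x
  proof (cases "x \<in> fund_domain")
    case True
    then show ?thesis using H_domain xE by simp
  next
    case False
    then obtain j where j: "j \<in> ind" "x \<in> bead j"
      using cases xE by blast
    have xK: "x \<notin> K" using xE by simp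
    note P1 = P[OF j xK, of 1]
    have "norm (h j (P 1 j x)) = 1"
      using P1(3) s(1)[OF h0[OF j xK], of 1] by simp
    then have nj: "P 1 j x \<notin> open_bead j"
      using sph[OF j(1), of "P 1 j x"] P1(1) by auto
    have "P 1 j x \<notin> open_bead i" if "i \<in> ind" for i
    proof
      assume i: "P 1 j x \<in> open_bead i"
      then have "i = j"
        using bead_unique[OF that j(1)] P1(1) open_bead_subset by auto
      with i nj show False by simp
    qed
    then show ?thesis
      using H_E[OF xE, of 1] H_bead[OF j] by (auto simp: fund_domain_def)
  qed
  have contH: "continuous_on ({0..1} \<times> ?E) H"
  proof (rule continuous_on_finite_closed_cover[of "{..k}" "\<lambda>j. if j = 0 then UNIV \<times> fund_domain else UNIV \<times> bead j"])
    show "closed (if i = 0 then UNIV \<times> fund_domain else UNIV \<times> bead i)" for i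
      using compact_domain closed_bead by (simp add: compact_imp_closed closed_Times)
    show "{0..1} \<times> ?E \<subseteq> (\<Union>j\<in>{..k}. if j = 0 then UNIV \<times> fund_domain else UNIV \<times> bead j)"
    proof clarify
      fix u x assume "x \<in> unit_sphere" "x \<notin> K"
      then consider "x \<in> fund_domain" | j where "j \<in> ind" "x \<in> bead j"
        using cases by blast
      then show "(u, x) \<in> (\<Union>j\<in>{..k}. if j = 0 then UNIV \<times> fund_domain else UNIV \<times> bead j)"
      proof cases
        case (2 j)
        then show ?thesis
          by (intro UN_I[of j]) (auto simp: ind_def)
      qed auto
    qed
    fix i assume "i \<in> {..k}"
    show "continuous_on ({0..1} \<times> ?E \<inter> (if i = 0 then UNIV \<times> fund_domain else UNIV \<times> bead i)) H"
    proof (cases "i = 0")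
      case True
      have "continuous_on ({0..1} \<times> ?E \<inter> UNIV \<times> fund_domain) H"
        by (rule continuous_on_eq[OF continuous_on_snd[OF continuous_on_id]]) (auto simp: H_domain)
      with True show ?thesis by simp
    next
      case False
      with \<open>i \<in> {..k}\<close> have i: "i \<in> ind" by (auto simp: ind_def)
      let ?X = "{0..1} \<times> ?E \<inter> UNIV \<times> bead i"
      have hs: "continuous_on ?X (\<lambda>z. h i (snd z))"
        by (rule continuous_on_compose2[OF h(1)[OF i] continuous_on_snd[OF continuous_on_id]]) auto
      have "continuous_on ?X (\<lambda>z. s (fst z) (h i (snd z)) *\<^sub>R h i (snd z))"
        unfolding s_def
        by (intro continuous_intros hs) (use h0[OF i] in auto)
      then have "continuous_on ?X (\<lambda>z. P (fst z) i (snd z))"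
        unfolding P_def
        by (rule continuous_on_compose2[OF h(2)[OF i]]) (use scb[OF i] in auto)
      then have "continuous_on ?X H"
        by (rule continuous_on_eq) (auto simp: H_bead[OF i])
      with False show ?thesis by simp
    qed
  qed auto
  show thesis
  proof (rule that[of "\<lambda>x. H (1, x)"])
    show "continuous_on ?E (\<lambda>x. H (1, x))"
      by (rule continuous_on_compose2[OF contH]) (auto intro!: continuous_intros)
    show "(\<lambda>x. H (1, x)) \<in> ?E \<rightarrow> fund_domain - K"
      using H1 by auto
    show "homotopic_with_canon (\<lambda>_. True) ?E ?E id (\<lambda>x. H (1, x))"
      using contH H_E H0 by (subst homotopic_with) (auto intro!: exI[of _ H])
  qed
qed

end

section \<open>Locally flat points\<close>

text \<open>\<open>\<alpha>\<close> keeps the two normal coordinates and \<open>\<beta>\<close>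
  shrinks the plane into the unit disk. On the segment from \<open>\<beta> (\<alpha> v)\<close> to
  \<open>v\<close> the normal part is a positive multiple of that of \<open>v\<close>, so the
  segment avoids \<open>flat\<close>; it stays in the ball by convexity.\<close>

lemma ball_minus_flat_dominated:
  fixes B :: "('v::euclidean_space \<times> real \<times> real) set"
  defines "B \<equiv> ball 0 1 - flat"
  defines "\<alpha> \<equiv> \<lambda>v::'v \<times> real \<times> real. Complex (fst (snd v)) (snd (snd v))"
  defines "\<beta> \<equiv> \<lambda>z. (0::'v, Re z / (1 + cmod z), Im z / (1 + cmod z))"
  shows "continuous_on B \<alpha>" "\<alpha> \<in> B \<rightarrow> - {0}"
    "continuous_on (- {0}) \<beta>" "\<beta> \<in> - {0} \<rightarrow> B"
    "homotopic_with_canon (\<lambda>_. True) B B (\<beta> \<circ> \<alpha>) id"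
proof -
  have pos: "1 + cmod z > 0" for z
    by (simp add: add_pos_nonneg)
  have ne: "1 + cmod z \<noteq> 0" for z
    using pos[of z] by linarith
  show c\<alpha>: "continuous_on B \<alpha>"
    unfolding \<alpha>_def by (intro continuous_intros)
  show \<alpha>: "\<alpha> \<in> B \<rightarrow> - {0}"
    by (auto simp: \<alpha>_def B_def flat_def complex_eq_iff prod_eq_iff)
  show c\<beta>: "continuous_on (- {0}) \<beta>"
    unfolding \<beta>_def by (intro continuous_intros) (auto simp: ne)
  have \<beta>_eq: "\<beta> z = (0, (1 / (1 + cmod z)) *\<^sub>R (Re z, Im z))" for z
    by (simp add: \<beta>_def)
  show \<beta>: "\<beta> \<in> - {0} \<rightarrow> B"
  proof
    fix z :: complex assume z: "z \<in> - {0}"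
    have "norm (\<beta> z) = cmod z / (1 + cmod z)"
      unfolding \<beta>_eq norm_Pair norm_scaleR using pos[of z]
      by (simp add: norm_Pair cmod_def)
    also have "\<dots> < 1"
      using pos[of z] by simp
    finally show "\<beta> z \<in> B"
      using z ne[of z] by (auto simp: B_def flat_def \<beta>_def complex_eq_iff prod_eq_iff)
  qed
  show "homotopic_with_canon (\<lambda>_. True) B B (\<beta> \<circ> \<alpha>) id"
  proof (rule homotopic_with_linear)
    show "continuous_on B (\<beta> \<circ> \<alpha>)"
      using c\<alpha> \<alpha> by (intro continuous_on_compose continuous_on_subset[OF c\<beta>]) auto
    fix v assume v: "v \<in> B"
    then have b: "(\<beta> \<circ> \<alpha>) v \<in> B"
      using \<alpha> \<beta> by auto
    show "closed_segment ((\<beta> \<circ> \<alpha>) v) (id v) \<subseteq> B"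
    proof
      fix y assume y: "y \<in> closed_segment ((\<beta> \<circ> \<alpha>) v) (id v)"
      then obtain u where u: "0 \<le> u" "u \<le> 1" "y = (1 - u) *\<^sub>R \<beta> (\<alpha> v) + u *\<^sub>R v"
        by (auto simp: closed_segment_def)
      have "y \<in> ball 0 1"
        using y v b closed_segment_subset[of "(\<beta> \<circ> \<alpha>) v" "ball 0 1" "id v"] by (auto simp: B_def)
      moreover have "snd y = ((1 - u) / (1 + cmod (\<alpha> v)) + u) *\<^sub>R snd v"
        by (simp add: u(3) \<beta>_def \<alpha>_def prod_eq_iff algebra_simps)
      moreover have "(1 - u) / (1 + cmod (\<alpha> v)) + u > 0"
        using u pos[of "\<alpha> v"] by (cases "u = 0") (auto intro!: add_nonneg_pos)
      ultimately show "y \<in> B"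
        using v by (auto simp: B_def flat_def)
    qed
  qed (rule continuous_on_id')
qed

context beaded_subset
begin

text \<open>\<open>G\<close> runs from the complement of \<open>K\<close> through \<open>U\<close>
  into the model ball and \<open>F\<close> returns by folding. As the word is a section of folding,
  \<open>F \<circ> G\<close> equals \<open>\<rho>\<close> on the nose, which is homotopic to the
  identity.\<close>

lemma locally_flat_imp_dominated:
  fixes h :: "'a \<Rightarrow> 'b::euclidean_space \<times> real \<times> real"
  assumes \<rho>: "continuous_on (unit_sphere - K) \<rho>" "\<rho> \<in> unit_sphere - K \<rightarrow> fund_domain - K"
    "homotopic_with_canon (\<lambda>_. True) (unit_sphere - K) (unit_sphere - K) id \<rho>"
    and w: "w \<noteq> []" "set w \<subseteq> ind" "distinct_adj w" "wmap w ` fund_domain \<subseteq> U"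
    and U: "U \<subseteq> unit_sphere"
    and hg: "pair_homeomorphism U (U \<inter> limit_space) (ball 0 1) (ball 0 1 \<inter> flat) h g"
  obtains \<alpha> :: "'a \<Rightarrow> complex" and \<beta> where
    "continuous_on (unit_sphere - K) \<alpha>" "\<alpha> \<in> unit_sphere - K \<rightarrow> - {0}"
    "continuous_on (- {0}) \<beta>" "\<beta> \<in> - {0} \<rightarrow> unit_sphere - K"
    "homotopic_with_canon (\<lambda>_. True) (unit_sphere - K) (unit_sphere - K) (\<beta> \<circ> \<alpha>) id"
proof -
  let ?E = "unit_sphere - K" and ?Z = "unit_sphere - limit_space"
  define B :: "('b \<times> real \<times> real) set" where "B = ball 0 1 - flat"
  obtain \<alpha>' :: "'b \<times> real \<times> real \<Rightarrow> complex" and \<beta>' where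
    ab: "continuous_on B \<alpha>'" "\<alpha>' \<in> B \<rightarrow> - {0}" "continuous_on (- {0}) \<beta>'" "\<beta>' \<in> - {0} \<rightarrow> B"
      "homotopic_with_canon (\<lambda>_. True) B B (\<beta>' \<circ> \<alpha>') id"
    using ball_minus_flat_dominated unfolding B_def by blast
  have h: "continuous_on U h" "continuous_on (ball 0 1) g" "\<And>x. x \<in> U \<Longrightarrow> g (h x) = x"
    "\<And>v. v \<in> ball 0 1 \<Longrightarrow> h (g v) = v" "h ` U = ball 0 1" "g ` ball 0 1 = U"
    "h ` (U \<inter> limit_space) = ball 0 1 \<inter> flat"
    using hg unfolding pair_homeomorphism_def homeomorphism_def by blast+
  have hB: "h x \<in> B" if x: "x \<in> U - limit_space" for x
  proof -
    have "h x \<notin> flat"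
    proof
      assume "h x \<in> flat"
      then have "h x \<in> h ` (U \<inter> limit_space)"
        using x h(5,7) by blast
      then obtain y where "y \<in> U \<inter> limit_space" "h x = h y" by blast
      then show False
        using h(3) x by (metis DiffE IntE)
    qed
    then show ?thesis
      using x h(5) by (auto simp: B_def)
  qed
  have gB: "g v \<in> U - limit_space" if v: "v \<in> B" for v
  proof -
    have "v \<in> ball 0 1" "v \<notin> flat"
      using v by (auto simp: B_def)
    then have "g v \<in> U" "h (g v) = v"
      using h(4,6) by blast+
    moreover have "g v \<notin> limit_space"
    proof
      assume "g v \<in> limit_space"
      with \<open>g v \<in> U\<close> \<open>h (g v) = v\<close> h(7) have "v \<in> flat"
        by (metis IntI IntE imageI)
      with \<open>v \<notin> flat\<close> show False ..
    qed
    ultimately show ?thesis by blast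
  qed
  define F where "F = fold_to_domain \<circ> g"
  define G where "G = h \<circ> (wmap w \<circ> \<rho>)"
  have w\<rho>: "wmap w (\<rho> x) \<in> U - limit_space" "fold_to_domain (wmap w (\<rho> x)) = \<rho> x" if "x \<in> ?E" for x
  proof -
    have "\<rho> x \<in> fund_domain - K"
      using that \<rho>(2) by blast
    then show "wmap w (\<rho> x) \<in> U - limit_space" "fold_to_domain (wmap w (\<rho> x)) = \<rho> x"
      using wmap_section[OF w(1-3)] w(4) by blast+
  qed
  have F: "continuous_on B F" "F \<in> B \<rightarrow> ?E"
  proof -
    show "continuous_on B F"
      unfolding F_def
    proof (rule continuous_on_compose)
      show "continuous_on B g"
        by (rule continuous_on_subset[OF h(2)]) (auto simp: B_def)
      show "continuous_on (g ` B) fold_to_domain"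
        by (rule continuous_on_subset[OF continuous_on_fold_to_domain]) (use gB U in blast)
    qed
    show "F \<in> B \<rightarrow> ?E"
      using gB U fold_to_domain_in by (fastforce simp: F_def fund_domain_def)
  qed
  have G: "continuous_on ?E G" "G \<in> ?E \<rightarrow> B"
  proof -
    show "continuous_on ?E G"
      unfolding G_def
    proof (intro continuous_on_compose \<rho>(1))
      show "continuous_on (\<rho> ` ?E) (wmap w)"
        by (rule continuous_on_subset[OF continuous_on_wmap[OF w(2)]])
           (use \<rho>(2) in \<open>auto simp: fund_domain_def\<close>)
      show "continuous_on ((wmap w \<circ> \<rho>) ` ?E) h"
        by (rule continuous_on_subset[OF h(1)]) (use w\<rho> in auto)
    qed
    show "G \<in> ?E \<rightarrow> B"
      using hB w\<rho>(1) by (auto simp: G_def)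
  qed
  have FG: "(F \<circ> id \<circ> G) x = \<rho> x" if "x \<in> ?E" for x
    using w\<rho>[OF that] h(3) by (simp add: F_def G_def)
  show thesis
  proof (rule that[of "\<alpha>' \<circ> G" "F \<circ> \<beta>'"])
    show "continuous_on ?E (\<alpha>' \<circ> G)" "continuous_on (- {0}) (F \<circ> \<beta>')"
      using F G ab by (blast intro: continuous_on_compose continuous_on_subset)+
    show "\<alpha>' \<circ> G \<in> ?E \<rightarrow> - {0}" "F \<circ> \<beta>' \<in> - {0} \<rightarrow> ?E"
      using F(2) G(2) ab(2,4) by (auto simp: Pi_iff)
    \<comment> \<open>The detour through the punctured plane is inserted between \<open>G\<close>
      and \<open>F\<close>, where it is homotopic to the identity.\<close>
    have "homotopic_with_canon (\<lambda>_. True) ?E ?E (F \<circ> (\<beta>' \<circ> \<alpha>') \<circ> G) (F \<circ> id \<circ> G)"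
      by (rule homotopic_with_compose_continuous_right[OF
            homotopic_with_compose_continuous_left[OF ab(5) F] G])
    moreover have "homotopic_with_canon (\<lambda>_. True) ?E ?E id (F \<circ> id \<circ> G)"
      by (rule homotopic_with_eq[OF \<rho>(3)]) (use FG in auto)
    ultimately have "homotopic_with_canon (\<lambda>_. True) ?E ?E (F \<circ> (\<beta>' \<circ> \<alpha>') \<circ> G) id"
      by (meson homotopic_with_trans homotopic_with_sym)
    then show "homotopic_with_canon (\<lambda>_. True) ?E ?E (F \<circ> \<beta>' \<circ> (\<alpha>' \<circ> G)) id"
      by (simp add: comp_assoc)
  qed
qed

end

theorem lemma2p13:
  fixes K :: "'n::finite sphere_space set"
    and k :: nat and c :: "nat \<Rightarrow> 'n sphere_space" and r :: "nat \<Rightarrow> real"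
    and b :: "'n sphere_space"
  assumes "CARD('n) > 1"
    and "k \<ge> 3"
    and "smooth_knot K"
    and "nontrivial_knot K"
    and "b \<in> unit_sphere - K"
    and "\<not> fundamental_group (unit_sphere - K) b \<cong> integer_group"
    and "beaded_necklace k K c r"
  shows "\<forall>x \<in> limit_set k c r. wild_at (inverse_limit_space k K c r) x"
proof
  obtain f :: "real \<times> (real^'n) \<Rightarrow> 'n sphere_space" and f' where
    K: "K \<subseteq> unit_sphere" and f: "homeomorphism unit_sphere K f f'"
    using assms(3) unfolding smooth_knot_def smooth_sphere_embedding_def by blast
  have Khom: "K homeomorphic (unit_sphere :: (real \<times> (real^'n)) set)"
    using homeomorphism_symD[OF f] unfolding homeomorphic_def by blast
  interpret beaded_subset k c r K
  proof
    show "norm (c j) = 1" if "j \<in> {1..k}" for j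
    proof -
      have "c j \<in> unit_sphere"
        using assms(7) that K unfolding beaded_necklace_def by blast
      then show ?thesis by simp
    qed
    show "0 < r j \<and> r j < 2" if "j \<in> {1..k}" for j
      using assms(7) that unfolding beaded_necklace_def by blast
    show "disjoint_family_on (\<lambda>j. round_ball (c j) (r j)) {1..k}"
      using assms(7) unfolding beaded_necklace_def by blast
  qed fact
  fix x assume x: "x \<in> limit_set k c r"
  have "x \<in> limit_space"
    unfolding inverse_limit_space_def using limit_set_subset_stage[OF x] by blast
  moreover have False if flat: "locally_flat_at limit_space x"
  proof -
    obtain U h g where U: "openin (top_of_set unit_sphere) U" "x \<in> U"
      and hg: "pair_homeomorphism U (U \<inter> limit_space) (ball 0 1 :: 'n disk_space set) (ball 0 1 \<inter> flat) h g"
      using flat unfolding locally_flat_at_def by blast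
    have "2 \<le> DIM('n sphere_space)" "2 \<le> k"
      using assms(2) by auto
    then obtain w where w: "w \<noteq> []" "set w \<subseteq> ind" "distinct_adj w" "wmap w ` fund_domain \<subseteq> U"
      using limit_set_small_word[OF _ _ x U] by blast
    \<comment> \<open>Equality of the dimensions of punctured sphere and disk is what invariance of
      domain asks for.\<close>
    have dim: "DIM('n sphere_space) = Suc (DIM('n disk_space))"
      by simp
    have "\<exists>h g. pair_homeomorphism (bead j) (bead j \<inter> K) (cball 0 1 :: 'n disk_space set) (cball 0 1 \<inter> flat) h g"
      if "j \<in> ind" for j
      using assms(7) that unfolding beaded_necklace_def trivial_tangle_def ind_def by blast
    from retraction_off_beads[OF dim this] obtain \<rho> where
      \<rho>: "continuous_on (unit_sphere - K) \<rho>" "\<rho> \<in> unit_sphere - K \<rightarrow> fund_domain - K"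
        "homotopic_with_canon (\<lambda>_. True) (unit_sphere - K) (unit_sphere - K) id \<rho>"
      by blast
    obtain \<alpha> \<beta> where
      "continuous_on (unit_sphere - K) \<alpha>" "\<alpha> \<in> unit_sphere - K \<rightarrow> - {0 :: complex}"
      "continuous_on (- {0}) \<beta>" "\<beta> \<in> - {0} \<rightarrow> unit_sphere - K"
      "homotopic_with_canon (\<lambda>_. True) (unit_sphere - K) (unit_sphere - K) (\<beta> \<circ> \<alpha>) id"
      using locally_flat_imp_dominated[OF \<rho> w openin_imp_subset[OF U(1)] hg] by blast
    then have "fundamental_group (unit_sphere - K) b \<cong> integer_group \<or> simply_connected (unit_sphere - K)"
      by (rule fundamental_group_dominated_by_punctured_plane[OF assms(5)])
    with assms(6) codim_2_sphere_complement_not_simply_connected[OF K Khom] show False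
      by blast
  qed
  ultimately show "wild_at limit_space x"
    unfolding wild_at_def by blast
qed

end
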